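(* Let $A,B,D,E\in\mathbb C$ with $\operatorname{Im}(A\bar D+B\bar E)=0$, and let $N$ be the set of all points $(\zeta_1,\zeta_2,\zeta_3)\in\mathbb C^3$, for $y_1,y_2,t\in\mathbb R$, where $$\zeta_1=y_1^2e^{it}+y_1(De^{it/2}+Ee^{-it/2})+y_2(Ae^{it/2}+Be^{-it/2})-\tfrac16A\bar Be^{2it}+(A\bar A+\tfrac13B\bar B)e^{it}-i(A^2+\bar AB)t-\tfrac23ABe^{-it}-\tfrac16B^2e^{-2it},$$ $$\zeta_2=-iy_1^2e^{-it}+iy_1(-\bar De^{-it/2}+\bar Ee^{it/2})+iy_2(\bar Ae^{-it/2}-\bar Be^{it/2})+\tfrac i6\bar B^2e^{2it}-\tfrac{2i}3\bar A\bar Be^{it}+(\bar A^2-A\bar B)t-i(A\bar A+\tfrac13B\bar B)e^{-it}-\tfrac i6\bar ABe^{-2it},$$ $$\zeta_3=y_1y_2+y_1\bigl(2Ae^{-it/2}-2\bar Ae^{it/2}-\tfrac23Be^{-3it/2}-\tfrac23\bar Be^{3it/2}\bigr)-\tfrac12(A\bar E+\bar BD)e^{it}-i\operatorname{Re}(A\bar D-B\bar E)\,t-\tfrac12(\bar AE+B\bar D)e^{-it}.$$ Then $N$ is a special Lagrangian $3$-fold in $\mathbb C^3$ (wherever it is nonsingular). Furthermore, any special Lagrangian $3$-fold in $\mathbb C^3$ obtained from the construction ( * ) of the context with $\dim_{\mathbb R}\langle\mathbf z_1(t),\mathbf z_2(t),\mathbf z_3(t)\rangle_{\mathbb R}=2$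 for generic $t\in\mathbb R$ is isomorphic to one of this family under an automorphism of $\mathbb C^3$.
   Context: On $\mathbb C^3$ set $g=\sum_j|dz_j|^2$, $\omega=\frac i2\sum_j dz_j\wedge d\bar z_j$ (so $\omega(\mathbf u,\mathbf v)=\operatorname{Im}\sum_j\bar u_jv_j$) and $\Omega=dz_1\wedge dz_2\wedge dz_3$. A special Lagrangian $3$-fold is an oriented real $3$-dimensional submanifold $L$ calibrated by $\operatorname{Re}\Omega$; equivalently, a real $3$-submanifold (with a suitable orientation) on which $\omega|_L\equiv0$ and $\operatorname{Im}\Omega|_L\equiv0$. "Wherever it is nonsingular" refers to the points where $N$, the image of the parametrization by $(y_1,y_2,t)$, is a nonsingular (immersed) $3$-submanifold, in particular where the parametrization is an immersion. Automorphisms of $\mathbb C^3$ are elements of $\mathrm{SU}(3)\ltimes\mathbb C^3$ acting by special unitary maps and translations. $\langle\ldots\rangle_{\mathbb R}$ is the real span. Cross product: $(r_1,r_2,r_3)\times(s_1,s_2,s_3)=\frac12(\bar r_2\bar s_3-\bar r_3\bar s_2,\ \bar r_3\bar s_1-\bar r_1\bar s_3,\ \bar r_1\bar s_2-\bar r_2\bar s_1)$. Construction ( * ): differentiable functions $\mathbf z_1,\ldots,\mathbf z_6:\mathbb R\to\mathbb C^3$ satisfying at $t=0$ (hence for all $t$) $\omega(\mathbf z_2,\mathbf z_3)=\omega(\mathbf z_1,\mathbf z_3)=\omega(\mathbf z_1,\mathbf z_2)=0$, $\omega(\mathbf z_1,\mathbf z_5)+\omega(\mathbf z_2,\mathbf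 z_5)-\omega(\mathbf z_3,\mathbf z_4)=0$, $-\omega(\mathbf z_1,\mathbf z_4)+\omega(\mathbf z_2,\mathbf z_4)+\omega(\mathbf z_3,\mathbf z_5)=0$, $\omega(\mathbf z_4,\mathbf z_5)=0$, and for all $t$ the equations $\dot{\mathbf z}_1=2\mathbf z_2\times\mathbf z_3$, $\dot{\mathbf z}_2=2\mathbf z_1\times\mathbf z_3$, $\dot{\mathbf z}_3=-2\mathbf z_1\times\mathbf z_2$, $\dot{\mathbf z}_4=\mathbf z_1\times\mathbf z_5+\mathbf z_2\times\mathbf z_5-\mathbf z_3\times\mathbf z_4$, $\dot{\mathbf z}_5=-\mathbf z_1\times\mathbf z_4+\mathbf z_2\times\mathbf z_4+\mathbf z_3\times\mathbf z_5$, $\dot{\mathbf z}_6=\mathbf z_4\times\mathbf z_5$; the associated $3$-fold is $\{\frac12(y_1^2+y_2^2)\mathbf z_1(t)+\frac12(y_1^2-y_2^2)\mathbf z_2(t)+y_1y_2\mathbf z_3(t)+y_1\mathbf z_4(t)+y_2\mathbf z_5(t)+\mathbf z_6(t):y_1,y_2,t\in\mathbb R\}$. *)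

theory Defs
  imports "HOL-Analysis.Analysis"
begin

section \<open>The flat Calabi-Yau structure of complex 3-space\<close>

text \<open>The metric \<open>g\<close> is the library inner product \<open>(\<bullet>)\<close> on \<^typ>\<open>complex^3\<close>, which is real-valued;
  \<^const>\<open>span\<close> and \<^const>\<open>dim\<close> are the real span and the real dimension.\<close>

definition omega :: "complex^3 \<Rightarrow> complex^3 \<Rightarrow> real" where
  "omega u v = Im (\<Sum>j\<in>UNIV. cnj (u$j) * v$j)"

definition Omega :: "complex^3 \<Rightarrow> complex^3 \<Rightarrow> complex^3 \<Rightarrow> complex" where
  "Omega u v w = det (vector [u, v, w] :: complex^3^3)"

definition ccross :: "complex^3 \<Rightarrow> complex^3 \<Rightarrow> complex^3"  (infixr \<open>\<otimes>\<^sub>c\<close> 75) where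
  "r \<otimes>\<^sub>c s = (1/2) *\<^sub>R vector
     [cnj (r$2) * cnj (s$3) - cnj (r$3) * cnj (s$2),
      cnj (r$3) * cnj (s$1) - cnj (r$1) * cnj (s$3),
      cnj (r$1) * cnj (s$2) - cnj (r$2) * cnj (s$1)]"


section \<open>Special Lagrangian 3-folds\<close>

text \<open>A real 3-plane is calibrated by \<open>Re \<Omega>\<close> if, for one of its two orientations, \<open>Re \<Omega>\<close> restricts to
  the volume form, i.e. takes the value 1 on a positively oriented orthonormal basis. Such an
  orientation is unique, and since \<open>Re \<Omega>\<close> does not vanish on the plane the orientations fit together
  continuously along a submanifold all of whose tangent spaces are calibrated.\<close>

definition special_lagrangian_plane :: "(complex^3) set \<Rightarrow> bool" where
  "special_lagrangian_plane V \<longleftrightarrow>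
     (\<exists>e1 e2 e3. V = span {e1, e2, e3}
        \<and> norm e1 = 1 \<and> norm e2 = 1 \<and> norm e3 = 1
        \<and> e1 \<bullet> e2 = 0 \<and> e1 \<bullet> e3 = 0 \<and> e2 \<bullet> e3 = 0
        \<and> Re (Omega e1 e2 e3) = 1)"

definition C1_immersion ::
    "(real^3) set \<Rightarrow> (real^3 \<Rightarrow> complex^3) \<Rightarrow> (real^3 \<Rightarrow> real^3 \<Rightarrow> complex^3) \<Rightarrow> bool" where
  "C1_immersion W f f' \<longleftrightarrow> open W
     \<and> (\<forall>x\<in>W. (f has_derivative f' x) (at x) \<and> inj (f' x))
     \<and> (\<forall>v. continuous_on W (\<lambda>x. f' x v))"

text \<open>A subset \<open>N\<close> is special Lagrangian wherever it is nonsingular: every immersed (in particular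
  every embedded) 3-dimensional piece of \<open>N\<close> has calibrated tangent spaces. Quantifying over all
  local parametrizations \<open>f\<close> with image in \<open>N\<close> covers the points where a given parametrization of
  \<open>N\<close> is an immersion, and also points where \<open>N\<close> happens to be a submanifold although the given
  parametrization degenerates.\<close>

definition special_lagrangian_where_nonsingular :: "(complex^3) set \<Rightarrow> bool" where
  "special_lagrangian_where_nonsingular N \<longleftrightarrow>
     (\<forall>W f f'. C1_immersion W f f' \<and> f ` W \<subseteq> N \<longrightarrow>
        (\<forall>x\<in>W. special_lagrangian_plane (range (f' x))))"


section \<open>Automorphisms\<close>

definition special_unitary :: "complex^3^3 \<Rightarrow> bool" where
  "special_unitary U \<longleftrightarrow> U ** (\<chi> i j. cnj (U$j$i)) = mat 1 \<and> det U = 1"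

definition automorphism :: "(complex^3 \<Rightarrow> complex^3) \<Rightarrow> bool" where
  "automorphism F \<longleftrightarrow> (\<exists>U b. special_unitary U \<and> F = (\<lambda>v. U *v v + b))"


section \<open>The construction from evolving quadratic maps\<close>

definition construction_data ::
    "(real \<Rightarrow> complex^3) \<Rightarrow> (real \<Rightarrow> complex^3) \<Rightarrow> (real \<Rightarrow> complex^3) \<Rightarrow>
     (real \<Rightarrow> complex^3) \<Rightarrow> (real \<Rightarrow> complex^3) \<Rightarrow> (real \<Rightarrow> complex^3) \<Rightarrow> bool" where
  "construction_data z1 z2 z3 z4 z5 z6 \<longleftrightarrow>
     omega (z2 0) (z3 0) = 0 \<and> omega (z1 0) (z3 0) = 0 \<and> omega (z1 0) (z2 0) = 0
     \<and> omega (z1 0) (z5 0) + omega (z2 0) (z5 0) - omega (z3 0) (z4 0) = 0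
     \<and> - omega (z1 0) (z4 0) + omega (z2 0) (z4 0) + omega (z3 0) (z5 0) = 0
     \<and> omega (z4 0) (z5 0) = 0
     \<and> (\<forall>t.
          (z1 has_vector_derivative 2 *\<^sub>R (z2 t \<otimes>\<^sub>c z3 t)) (at t)
        \<and> (z2 has_vector_derivative 2 *\<^sub>R (z1 t \<otimes>\<^sub>c z3 t)) (at t)
        \<and> (z3 has_vector_derivative (-2) *\<^sub>R (z1 t \<otimes>\<^sub>c z2 t)) (at t)
        \<and> (z4 has_vector_derivative
             (z1 t \<otimes>\<^sub>c z5 t) + (z2 t \<otimes>\<^sub>c z5 t) - (z3 t \<otimes>\<^sub>c z4 t)) (at t)
        \<and> (z5 has_vector_derivative
             - (z1 t \<otimes>\<^sub>c z4 t) + (z2 t \<otimes>\<^sub>c z4 t) + (z3 t \<otimes>\<^sub>c z5 t)) (at t)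
        \<and> (z6 has_vector_derivative z4 t \<otimes>\<^sub>c z5 t) (at t))"

definition construction_fold ::
    "(real \<Rightarrow> complex^3) \<Rightarrow> (real \<Rightarrow> complex^3) \<Rightarrow> (real \<Rightarrow> complex^3) \<Rightarrow>
     (real \<Rightarrow> complex^3) \<Rightarrow> (real \<Rightarrow> complex^3) \<Rightarrow> (real \<Rightarrow> complex^3) \<Rightarrow> (complex^3) set" where
  "construction_fold z1 z2 z3 z4 z5 z6 =
     {((y1\<^sup>2 + y2\<^sup>2) / 2) *\<^sub>R z1 t + ((y1\<^sup>2 - y2\<^sup>2) / 2) *\<^sub>R z2 t + (y1 * y2) *\<^sub>R z3 t
        + y1 *\<^sub>R z4 t + y2 *\<^sub>R z5 t + z6 t | y1 y2 t. True}"

definition for_generic :: "(real \<Rightarrow> bool) \<Rightarrow> bool" where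
  "for_generic P \<longleftrightarrow> (\<exists>S. open S \<and> closure S = UNIV \<and> (\<forall>t\<in>S. P t))"


section \<open>The explicit family\<close>

definition zeta1 :: "complex \<Rightarrow> complex \<Rightarrow> complex \<Rightarrow> complex \<Rightarrow> real \<Rightarrow> real \<Rightarrow> real \<Rightarrow> complex" where
  "zeta1 A B D E y1 y2 t =
     y1\<^sup>2 * cis t + y1 * (D * cis (t/2) + E * cis (-t/2)) + y2 * (A * cis (t/2) + B * cis (-t/2))
     - 1/6 * A * cnj B * cis (2*t) + (A * cnj A + 1/3 * B * cnj B) * cis t
     - \<i> * (A\<^sup>2 + cnj A * B) * t - 2/3 * A * B * cis (-t) - 1/6 * B\<^sup>2 * cis (-2*t)"

definition zeta2 :: "complex \<Rightarrow> complex \<Rightarrow> complex \<Rightarrow> complex \<Rightarrow> real \<Rightarrow> real \<Rightarrow> real \<Rightarrow> complex" where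
  "zeta2 A B D E y1 y2 t =
     - \<i> * y1\<^sup>2 * cis (-t) + \<i> * y1 * (- cnj D * cis (-t/2) + cnj E * cis (t/2))
     + \<i> * y2 * (cnj A * cis (-t/2) - cnj B * cis (t/2))
     + \<i>/6 * (cnj B)\<^sup>2 * cis (2*t) - 2*\<i>/3 * cnj A * cnj B * cis t + ((cnj A)\<^sup>2 - A * cnj B) * t
     - \<i> * (A * cnj A + 1/3 * B * cnj B) * cis (-t) - \<i>/6 * cnj A * B * cis (-2*t)"

definition zeta3 :: "complex \<Rightarrow> complex \<Rightarrow> complex \<Rightarrow> complex \<Rightarrow> real \<Rightarrow> real \<Rightarrow> real \<Rightarrow> complex" where
  "zeta3 A B D E y1 y2 t =
     y1 * y2 + y1 * (2 * A * cis (-t/2) - 2 * cnj A * cis (t/2)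
                     - 2/3 * B * cis (-3*t/2) - 2/3 * cnj B * cis (3*t/2))
     - 1/2 * (A * cnj E + cnj B * D) * cis t - \<i> * Re (A * cnj D - B * cnj E) * t
     - 1/2 * (cnj A * E + B * cnj D) * cis (-t)"

definition family_fold :: "complex \<Rightarrow> complex \<Rightarrow> complex \<Rightarrow> complex \<Rightarrow> (complex^3) set" where
  "family_fold A B D E =
     {vector [zeta1 A B D E y1 y2 t, zeta2 A B D E y1 y2 t, zeta3 A B D E y1 y2 t] | y1 y2 t. True}"

end

theory Submission
  imports Defs
begin

text \<open>
  Write a fold of the construction as the image of
  \<open>\<phi>(y\<^sub>1, y\<^sub>2, t) = y\<^sub>1\<^sup>2 P(t) + y\<^sub>1 y\<^sub>2 Q(t) + y\<^sub>2\<^sup>2 R(t) + y\<^sub>1 L(t) + y\<^sub>2 M(t) + K(t)\<close>. The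
  evolution equations and the constraints say exactly that \<open>\<partial>\<^sub>t\<phi> = \<partial>\<^sub>1\<phi> \<times> \<partial>\<^sub>2\<phi>\<close> and
  \<open>\<omega>(\<partial>\<^sub>1\<phi>, \<partial>\<^sub>2\<phi>) = 0\<close>, coefficient by coefficient in \<open>y\<close>. Since \<open>\<Omega>(u, v, w)\<close> is twice the Hermitian
  product of \<open>u \<times> v\<close> with \<open>w\<close>, the span of \<open>u\<close>, \<open>v\<close>, \<open>u \<times> v\<close> with \<open>\<omega>(u, v) = 0\<close> is isotropic for \<open>\<omega>\<close>
  and for \<open>Im \<Omega>\<close>. So the image of the differential of \<open>\<phi>\<close> is special Lagrangian wherever \<open>\<phi>\<close> is an
  immersion.

  Singular points of \<open>\<phi>\<close> may still be smooth points of the image. Let \<open>f\<close> be any immersion with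
  values in the image of \<open>\<phi>\<close>. A variant of Sard's theorem (\<open>tangent_space_within_image\<close>) shows that
  the tangent space of \<open>f\<close> lies in the image of a differential of \<open>\<phi>\<close> on a dense set; being
  isotropic is a closed condition, and hence it holds at every point of \<open>f\<close>. The explicit family
  consists of solutions of the evolution equations with \<open>R = 0\<close> and \<open>Q\<close> the third unit vector, which
  gives the first half.

  For the second half, suppose that \<open>z\<^sub>1, z\<^sub>2, z\<^sub>3\<close> span a plane for generic \<open>t\<close>. Then
  \<open>\<Omega>(z\<^sub>1, z\<^sub>2, z\<^sub>3)\<close> vanishes on an open set, and its derivative is
  \<open>4 (\<bar>z\<^sub>2 \<times> z\<^sub>3\<bar>\<^sup>2 - \<bar>z\<^sub>1 \<times> z\<^sub>3\<bar>\<^sup>2 - \<bar>z\<^sub>1 \<times> z\<^sub>2\<bar>\<^sup>2)\<close>. A relation \<open>\<alpha>z\<^sub>1 + \<beta>z\<^sub>2 + \<gamma>z\<^sub>3 = 0\<close> makes the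
  three cross products proportional to \<open>\<alpha>, \<beta>, \<gamma>\<close>, so \<open>\<alpha>\<^sup>2 = \<beta>\<^sup>2 + \<gamma>\<^sup>2\<close> (\<open>null_relation\<close>). Rotations
  of the \<open>y\<close>-plane rotate \<open>(z\<^sub>2, z\<^sub>3)\<close> and fix \<open>z\<^sub>1\<close>, so one of them turns the relation into
  \<open>z\<^sub>1 = z\<^sub>2\<close>, that is \<open>R = 0\<close>, at one time. The norm of \<open>R\<close> is constant, so \<open>R = 0\<close> at all times,
  and then \<open>Q\<close> is constant (\<open>degenerate_reduction\<close>).

  What remains is to match initial values. A shear and a scaling of \<open>(y\<^sub>1, y\<^sub>2)\<close>, with the
  corresponding scaling of time, make \<open>Q\<close> a unit vector that is Hermitian orthogonal to \<open>P(0)\<close>, and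
  give \<open>P(0)\<close> the norm \<open>\<surd>2\<close>. A map in \<open>SU(3)\<close> takes both to their values in the family. A
  translation of \<open>(y\<^sub>1, y\<^sub>2)\<close> adjusts the real parts of the third components of \<open>L\<close> and \<open>M\<close>, whose
  imaginary parts are fixed by the constraints; the other components of \<open>L(0)\<close> and \<open>M(0)\<close> determine
  \<open>A, B, D, E\<close>, and the last constraint becomes the condition on these parameters. Solutions with
  equal initial values agree, because the difference of two solutions moves orthogonally to itself
  (\<open>degenerate_normal_form\<close>).
\<close>

section \<open>The Hermitian product, the cross product and the volume form\<close>

lemmas vec3_simps = sum_3 vector_3 vec_eq_iff forall_3

text \<open>The default rule for components leaves a real scaling of a complex number, which the ring
  normalisation rules do not see; turning it into a product makes identities of vectors into
  polynomial identities of components.\<close>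

lemma scaleR_nth: "(r *\<^sub>R v) $ i = complex_of_real r * v $ i" for v :: "complex^'n"
  by (simp add: scaleR_conv_of_real [where 'a = complex])

text \<open>Conjugate-linear in the first argument, like \<^const>\<open>omega\<close>: the metric is its real part and \<^const>\<open>omega\<close>
  its imaginary part.\<close>

definition herm :: "complex^3 \<Rightarrow> complex^3 \<Rightarrow> complex" where
  "herm u v = (\<Sum>j\<in>UNIV. cnj (u$j) * v$j)"

lemma herm_expand: "herm u v = cnj (u$1) * v$1 + cnj (u$2) * v$2 + cnj (u$3) * v$3"
  by (simp add: herm_def sum_3)

lemma omega_herm: "omega u v = Im (herm u v)"
  by (simp add: omega_def herm_def)

lemma inner_herm: "u \<bullet> v = Re (herm u v)"
  by (simp add: herm_expand inner_vec_def sum_3 inner_complex_def)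

lemma cnj_herm: "cnj (herm u v) = herm v u"
  by (simp add: herm_expand mult.commute)

lemma herm_self: "herm u u = complex_of_real ((norm u)\<^sup>2)"
  by (simp add: complex_eq_iff power2_norm_eq_inner inner_herm) (simp add: herm_expand)

lemma ccross_nth:
  "(r \<otimes>\<^sub>c s)$1 = (cnj (r$2) * cnj (s$3) - cnj (r$3) * cnj (s$2)) / 2"
  "(r \<otimes>\<^sub>c s)$2 = (cnj (r$3) * cnj (s$1) - cnj (r$1) * cnj (s$3)) / 2"
  "(r \<otimes>\<^sub>c s)$3 = (cnj (r$1) * cnj (s$2) - cnj (r$2) * cnj (s$1)) / 2"
  by (simp_all add: ccross_def scaleR_nth del: vector_scaleR_component)

lemma Omega_expand:
  "Omega u v w = u$1 * (v$2 * w$3 - v$3 * w$2) + u$2 * (v$3 * w$1 - v$1 * w$3)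
     + u$3 * (v$1 * w$2 - v$2 * w$1)"
  by (simp add: Omega_def det_3 algebra_simps)

lemma bounded_bilinear_ccross: "bounded_bilinear (\<otimes>\<^sub>c)"
  unfolding bilinear_conv_bounded_bilinear [symmetric] bilinear_def
  by (auto intro!: linearI simp: vec3_simps ccross_nth scaleR_nth algebra_simps
      add_divide_distrib diff_divide_distrib simp del: vector_scaleR_component)

lemma bounded_bilinear_omega: "bounded_bilinear omega"
  unfolding bilinear_conv_bounded_bilinear [symmetric] bilinear_def
  by (auto intro!: linearI simp: omega_herm herm_expand algebra_simps)

interpretation ccross: bounded_bilinear "(\<otimes>\<^sub>c)" by (rule bounded_bilinear_ccross)
interpretation omega: bounded_bilinear omega by (rule bounded_bilinear_omega)

lemma ccross_skew: "u \<otimes>\<^sub>c v = - (v \<otimes>\<^sub>c u)"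
  by (simp add: vec3_simps ccross_nth field_simps)

lemma ccross_self [simp]: "u \<otimes>\<^sub>c u = 0"
  by (simp add: vec3_simps ccross_nth)

lemma omega_skew: "omega u v = - omega v u"
  by (simp add: omega_herm herm_expand)

lemma omega_self [simp]: "omega u u = 0"
  by (simp add: omega_herm herm_expand)

text \<open>The conjugations in the cross product are there to make this hold: up to a factor it represents
  the linear form \<open>\<Omega>(u, v, \<cdot>)\<close> in the Hermitian product. All orthogonality properties of the cross
  product follow because \<open>\<Omega>\<close> is alternating.\<close>

lemma herm_ccross: "herm (u \<otimes>\<^sub>c v) w = Omega u v w / 2"
  by (simp add: herm_expand ccross_nth Omega_expand field_simps)

lemma omega_ccross: "omega (u \<otimes>\<^sub>c v) w = Im (Omega u v w) / 2"
  by (simp add: omega_herm herm_ccross)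

lemma inner_ccross: "(u \<otimes>\<^sub>c v) \<bullet> w = Re (Omega u v w) / 2"
  by (simp add: inner_herm herm_ccross)

lemma omega_ccross_right: "omega w (u \<otimes>\<^sub>c v) = - Im (Omega u v w) / 2"
  by (subst omega_skew) (simp add: omega_ccross)

lemma Omega_repeated [simp]: "Omega u u v = 0" "Omega u v u = 0" "Omega v u u = 0"
  by (simp_all add: Omega_expand algebra_simps)

lemma omega_ccross_self:
  "omega (u \<otimes>\<^sub>c v) u = 0" "omega (u \<otimes>\<^sub>c v) v = 0"
  "omega u (u \<otimes>\<^sub>c v) = 0" "omega v (u \<otimes>\<^sub>c v) = 0"
  by (simp_all add: omega_ccross omega_ccross_right)

lemma Omega_permute:
  "Omega a c b = - Omega a b c" "Omega b c a = Omega a b c" "Omega c a b = Omega a b c"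
  "Omega b a c = - Omega a b c" "Omega c b a = - Omega a b c"
  by (simp_all add: Omega_expand algebra_simps)

text \<open>The value is real, so \<open>Im \<Omega>\<close> vanishes on the span of \<open>u\<close>, \<open>v\<close> and \<open>u \<times> v\<close>.\<close>

lemma Omega_ccross: "Omega u v (u \<otimes>\<^sub>c v) = complex_of_real (2 * (norm (u \<otimes>\<^sub>c v))\<^sup>2)"
  using herm_ccross [of u v "u \<otimes>\<^sub>c v"] by (simp add: herm_self mult.commute)

lemma inner_ccross_self: "(u \<otimes>\<^sub>c v) \<bullet> u = 0" "(u \<otimes>\<^sub>c v) \<bullet> v = 0"
   "u \<bullet> (u \<otimes>\<^sub>c v) = 0" "v \<bullet> (u \<otimes>\<^sub>c v) = 0"
  by (simp_all add: inner_ccross inner_commute [of _ "_ \<otimes>\<^sub>c _"])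

text \<open>Lagrange's identity.\<close>

lemma herm_ccross_ccross:
  "4 * herm (u \<otimes>\<^sub>c v) (u \<otimes>\<^sub>c v) = herm u u * herm v v - herm u v * herm v u"
  by (simp add: herm_expand ccross_nth field_simps)

section \<open>Special unitary maps\<close>

lemma herm_matrix_adjoint: "herm (U *v u) w = herm u ((\<chi> i j. cnj (U$j$i)) *v w)"
  by (simp add: herm_expand matrix_vector_mult_def sum_3 algebra_simps)

lemma special_unitary_inverse:
  assumes "special_unitary U"
  shows "(\<chi> i j. cnj (U$j$i)) *v (U *v u) = u" "U *v ((\<chi> i j. cnj (U$j$i)) *v u) = u"
  using assms matrix_left_right_inverse [of U "\<chi> i j. cnj (U$j$i)"]
  by (simp_all add: special_unitary_def matrix_vector_mul_assoc)

lemma herm_special_unitary: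
  assumes "special_unitary U"
  shows "herm (U *v u) (U *v v) = herm u v"
  by (simp add: herm_matrix_adjoint special_unitary_inverse [OF assms])

lemma Omega_matrix_mult: "Omega (U *v u) (U *v v) (U *v w) = det U * Omega u v w"
proof -
  have "(vector [U *v u, U *v v, U *v w] :: complex^3^3) = vector [u, v, w] ** transpose U"
    by (simp add: vec3_simps matrix_matrix_mult_def matrix_vector_mult_def transpose_def mult.commute)
  then show ?thesis
    by (simp add: Omega_def det_mul det_transpose mult.commute)
qed

text \<open>The cross product is defined by \<open>\<Omega>\<close> and the Hermitian product, and a special unitary map preserves
  both.\<close>

lemma ccross_special_unitary:
  assumes U: "special_unitary U"
  shows "U *v (u \<otimes>\<^sub>c v) = (U *v u) \<otimes>\<^sub>c (U *v v)"
proof -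
  have "(U *v (u \<otimes>\<^sub>c v)) \<bullet> x = ((U *v u) \<otimes>\<^sub>c (U *v v)) \<bullet> x" for x
  proof -
    define w where "w = (\<chi> i j. cnj (U$j$i)) *v x"
    have x: "x = U *v w" by (simp add: w_def special_unitary_inverse [OF U])
    show ?thesis
      using U by (simp add: x inner_herm herm_special_unitary herm_ccross Omega_matrix_mult
        special_unitary_def)
  qed
  then show ?thesis by (metis vector_eq_rdot)
qed

text \<open>A special unitary map preserves the cross product, so the required one must send \<open>q = 2 e \<times> p\<close> to
  \<open>(-i, 1, 0)\<close>. The vectors \<open>(1, -i, 0)\<close> and \<open>(-i, 1, 0)\<close> span the first two coordinates over \<open>\<complex>\<close>,
  which yields the preimages \<open>x1\<close> and \<open>x2\<close> of the first two unit vectors. The rows of the matrix are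
  the conjugates of \<open>x1\<close>, \<open>x2\<close>, \<open>e\<close>.\<close>

lemma special_unitary_frame:
  assumes e: "herm e e = 1" and p: "herm p p = 2" and ep: "herm e p = 0"
  obtains U where "special_unitary U" "U *v e = vector [0, 0, 1]" "U *v p = vector [1, -\<i>, 0]"
proof -
  define q where "q = 2 *\<^sub>R (e \<otimes>\<^sub>c p)"
  have scale: "herm (c *\<^sub>R u) v = c * herm u v" "herm u (c *\<^sub>R v) = c * herm u v" for c u v
    by (simp_all add: herm_expand scaleR_nth algebra_simps del: vector_scaleR_component)
  have pe: "herm p e = 0" using cnj_herm [of e p] ep by simp
  have q: "herm q e = 0" "herm q p = 0"
    by (simp_all add: q_def scale herm_ccross)
  have qq: "herm q q = 2"
    using herm_ccross_ccross [of e p] e p pe ep by (simp add: q_def scale)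
  have q': "herm e q = 0" "herm p q = 0"
    using q cnj_herm [of q e] cnj_herm [of q p] by simp_all
  define x1 where "x1 = (\<chi> j. (p$j + \<i> * q$j) / 2)"
  define x2 where "x2 = (\<chi> j. (\<i> * p$j + q$j) / 2)"
  have l: "herm x1 w = (herm p w - \<i> * herm q w) / 2" "herm x2 w = (- \<i> * herm p w + herm q w) / 2"
    "herm w x1 = (herm w p + \<i> * herm w q) / 2" "herm w x2 = (\<i> * herm w p + herm w q) / 2" for w
    by (simp_all add: x1_def x2_def herm_expand field_simps)
  note h = l e p ep pe q q' qq
  define U :: "complex^3^3" where "U = vector [\<chi> j. cnj (x1$j), \<chi> j. cnj (x2$j), \<chi> j. cnj (e$j)]"
  have Uv: "U *v w = vector [herm x1 w, herm x2 w, herm e w]" for w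
    by (simp add: U_def vec3_simps matrix_vector_mult_def herm_expand)
  have "U ** (\<chi> i j. cnj (U$j$i)) = (\<chi> i j. herm (vector [x1, x2, e] $ i) (vector [x1, x2, e] $ j))"
    by (simp add: U_def vec3_simps matrix_matrix_mult_def herm_expand)
  also have "\<dots> = mat 1"
    by (simp add: vec3_simps mat_def h field_simps)
  finally have 1: "U ** (\<chi> i j. cnj (U$j$i)) = mat 1" .
  have "cnj (det U) = Omega x1 x2 e"
    by (simp add: U_def Omega_expand det_3 algebra_simps)
  also have "\<dots> = Omega e p q / 2"
    by (simp add: Omega_expand x1_def x2_def field_simps)
  also have "\<dots> = 1"
    using herm_ccross [of e p q] qq by (simp add: q_def scale)
  finally have "det U = 1"
    by (metis complex_cnj_cnj complex_cnj_one)
  with 1 have "special_unitary U" by (simp add: special_unitary_def)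
  moreover have "U *v e = vector [0, 0, 1]" "U *v p = vector [1, -\<i>, 0]"
    by (simp_all add: Uv h)
  ultimately show ?thesis by (rule that)
qed

section \<open>Tangent spaces of immersions into the image of a differentiable map\<close>

lemma rank_matrix_less_if_not_inj:
  fixes T :: "real^'n \<Rightarrow> real^'m"
  assumes "linear T" "\<not> inj T"
  shows "rank (matrix T) < CARD('n)"
proof -
  have "(*v) (matrix T) = T" using matrix_works [of T] assms(1) by (simp add: fun_eq_iff)
  then show ?thesis using less_rank_noninjective [of "matrix T"] assms(2) by simp
qed

text \<open>Project by a left inverse \<open>\<pi>\<close> of the differential of \<open>f\<close> at \<open>x0\<close>. Near \<open>x0\<close> the image of \<open>f\<close> is a
  graph \<open>f \<circ> g\<close> over an open set \<open>V\<close>, where \<open>g\<close> inverts \<open>\<pi> \<circ> f\<close>. Put \<open>h = \<pi> \<circ> \<phi>\<close> and let \<open>Y\<close> be the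
  set of parameters at which \<open>\<phi>\<close> meets this graph; then \<open>h\<close> maps \<open>Y\<close> onto \<open>V\<close>. If the differentials
  of \<open>\<phi>\<close> and of \<open>f \<circ> g \<circ> h\<close> differ at a point of \<open>Y\<close>, then some directions are not tangent to \<open>Y\<close>,
  and within \<open>Y\<close> the map \<open>h\<close> also has a singular derivative. Sard's theorem in the form for
  derivatives within a set would make \<open>V\<close> negligible if that happened at all points of \<open>Y\<close> where \<open>h\<close>
  itself has an invertible derivative.\<close>

lemma tangent_space_within_image:
  fixes \<phi> :: "real^'n::{finite,wellorder} \<Rightarrow> 'e::euclidean_space"
    and f :: "real^'n::{finite,wellorder} \<Rightarrow> 'e"
  assumes \<phi>: "\<And>y. (\<phi> has_derivative \<phi>' y) (at y)"
    and W: "open W" "x0 \<in> W"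
    and f: "\<And>x. x \<in> W \<Longrightarrow> (f has_derivative f' x) (at x)" "inj (f' x0)"
    and cont: "\<And>v. continuous_on W (\<lambda>x. f' x v)"
    and img: "f ` W \<subseteq> range \<phi>"
  obtains x y where "x \<in> W" "range (f' x) \<subseteq> range (\<phi>' y)"
proof -
  have "linear (f' x0)" by (rule has_derivative_linear [OF f(1) [OF W(2)]])
  from linear_injective_left_inverse [OF this f(2)]
  obtain \<pi> where lin: "linear \<pi>" and \<pi>: "\<pi> \<circ> f' x0 = id" by blast
  have bl: "bounded_linear \<pi>" using lin linear_conv_bounded_linear by blast
  note d\<pi> = bounded_linear.has_derivative [OF bl]
  define F where "F x = Blinfun (\<lambda>v. \<pi> (f' x v))" for x
  have F: "blinfun_apply (F x) = (\<lambda>v. \<pi> (f' x v))" if "x \<in> W" for x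
    unfolding F_def using has_derivative_bounded_linear [OF d\<pi> [OF f(1) [OF that]]]
    by (rule bounded_linear_Blinfun_apply)
  have dp: "((\<lambda>x. \<pi> (f x)) has_derivative blinfun_apply (F x)) (at x)" if "x \<in> W" for x
    using d\<pi> [OF f(1) [OF that]] F [OF that] by simp
  have cF: "continuous_on W F"
  proof (rule continuous_on_blinfun_componentwise)
    fix i :: "real^'n::{finite,wellorder}"
    have "continuous_on W (\<lambda>x. \<pi> (f' x i))"
      using bounded_linear.continuous_on [OF bl cont] .
    then show "continuous_on W (\<lambda>x. blinfun_apply (F x) i)"
      by (rule continuous_on_eq) (simp add: F)
  qed
  have "id_blinfun o\<^sub>L F x0 = id_blinfun"
    using F [OF W(2)] \<pi> by (intro blinfun_eqI) (simp add: o_def fun_eq_iff)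
  then obtain U' V g g' where U': "U' \<subseteq> W" "x0 \<in> U'" and V: "open V" "\<pi> (f x0) \<in> V"
    and hom: "homeomorphism U' V (\<lambda>x. \<pi> (f x)) g"
    and g: "\<And>z. z \<in> V \<Longrightarrow> (g has_derivative g' z) (at z)"
    and g': "\<And>z. z \<in> V \<Longrightarrow> g' z = inv (blinfun_apply (F (g z)))"
    and bij: "\<And>z. z \<in> V \<Longrightarrow> bij (blinfun_apply (F (g z)))"
    using inverse_function_theorem [OF W(1) dp cF W(2)] by metis
  have gV: "g z \<in> W" if "z \<in> V" for z
    using hom that U'(1) by (auto simp: homeomorphism_def)
  define h where "h y = \<pi> (\<phi> y)" for y
  define h' where "h' y = (\<lambda>v. \<pi> (\<phi>' y v))" for y
  have h: "(h has_derivative h' y) (at y)" for y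
    using d\<pi> [OF \<phi>] by (simp add: h_def [abs_def] h'_def)
  define Y where "Y = {y. h y \<in> V \<and> \<phi> y = f (g (h y))}"
  have VY: "V \<subseteq> h ` Y"
  proof
    fix z assume z: "z \<in> V"
    obtain y where y: "f (g z) = \<phi> y" using img gV [OF z] by auto
    have "h y = z" using hom z by (simp add: h_def homeomorphism_def flip: y)
    with z y have "y \<in> Y" by (simp add: Y_def)
    with \<open>h y = z\<close> show "z \<in> h ` Y" by blast
  qed
  have "\<exists>y\<in>Y. range (f' (g (h y))) \<subseteq> range (\<phi>' y)"
  proof (rule ccontr)
    assume neg: "\<not> ?thesis"
    have "\<exists>T. (h has_derivative T) (at y within Y) \<and> rank (matrix T) < CARD('n)" if y: "y \<in> Y" for y
    proof (cases "inj (h' y)")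
      case False
      have "rank (matrix (h' y)) < CARD('n)"
        by (rule rank_matrix_less_if_not_inj [OF has_derivative_linear [OF h] False])
      then show ?thesis using has_derivative_at_withinI [OF h] by blast
    next
      case True
      have z: "h y \<in> V" and \<phi>y: "\<phi> y = f (g (h y))" using y by (auto simp: Y_def)
      define S where "S = (\<lambda>v. f' (g (h y)) (g' (h y) (h' y v)))"
      have S: "((\<lambda>y. f (g (h y))) has_derivative S) (at y)"
        unfolding S_def
        using has_derivative_compose [OF has_derivative_compose [OF h g [OF z]] f(1) [OF gV [OF z]]] .
      have "surj (h' y)"
        using has_derivative_linear [OF h] True linear_injective_imp_surjective by blast
      moreover have "surj (g' (h y))"
        using g' [OF z] bij [OF z] by (simp add: bij_is_surj bij_imp_bij_inv)
      ultimately have "range S = range (f' (g (h y)))"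
        unfolding S_def by (metis (no_types) image_image)
      with neg y have "S \<noteq> \<phi>' y" by (metis order_refl)
      then obtain v where v: "\<phi>' y v \<noteq> S v" by (metis ext)
      define G' where "G' = (\<lambda>w. \<phi>' y w - S w)"
      have G: "((\<lambda>y. \<phi> y - f (g (h y))) has_derivative G') (at y)"
        unfolding G'_def by (rule has_derivative_diff [OF \<phi> S])
      \<comment> \<open>The map \<open>\<phi> - f \<circ> g \<circ> h\<close> vanishes on \<open>Y\<close>, so multiples of it may be subtracted from \<open>h\<close> without
        changing \<open>h\<close> on \<open>Y\<close>; this multiple makes the derivative vanish at \<open>v\<close>.\<close>
      define T where "T = (\<lambda>w. h' y w - (G' w \<bullet> G' v) *\<^sub>R (h' y v /\<^sub>R (G' v \<bullet> G' v)))"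
      have T: "((\<lambda>y'. h y' - ((\<phi> y' - f (g (h y'))) \<bullet> G' v) *\<^sub>R (h' y v /\<^sub>R (G' v \<bullet> G' v)))
          has_derivative T) (at y within Y)"
        unfolding T_def
        by (intro has_derivative_diff has_derivative_scaleR_left
            has_derivative_inner_left has_derivative_at_withinI [OF h] has_derivative_at_withinI [OF G])
      have hT: "(h has_derivative T) (at y within Y)"
        by (rule has_derivative_transform [OF y _ T]) (simp add: Y_def)
      have "G' v \<noteq> 0" using v by (simp add: G'_def)
      then have "T v = 0" by (simp add: T_def)
      moreover have "v \<noteq> 0"
        using \<open>G' v \<noteq> 0\<close> has_derivative_linear [OF G] linear_0 by blast
      moreover have "T 0 = 0" using has_derivative_linear [OF hT] linear_0 by blast
      ultimately have "\<not> inj T" by (metis injD)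
      then have "rank (matrix T) < CARD('n)"
        by (rule rank_matrix_less_if_not_inj [OF has_derivative_linear [OF hT]])
      with hT show ?thesis by blast
    qed
    then obtain T where "\<And>y. y \<in> Y \<Longrightarrow> (h has_derivative T y) (at y within Y)"
      "\<And>y. y \<in> Y \<Longrightarrow> rank (matrix (T y)) < CARD('n)" by metis
    then have "negligible (h ` Y)" by (rule baby_Sard [OF order_refl])
    then have "negligible V" using VY negligible_subset by blast
    with V show False using open_not_negligible by blast
  qed
  then obtain y where "y \<in> Y" "range (f' (g (h y))) \<subseteq> range (\<phi>' y)" by blast
  then show ?thesis by (intro that [of "g (h y)" y] gV) (simp_all add: Y_def)
qed

section \<open>Special Lagrangian planes\<close>

text \<open>The Gram matrix of an orthonormal basis is the identity also for the Hermitian product when \<open>\<omega>\<close>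
  vanishes, so \<open>\<Omega>\<close> has modulus 1 on it. Being real, its value is \<open>1\<close> or \<open>-1\<close>; in the second case the
  other orientation is calibrated.\<close>

lemma special_lagrangian_plane_orthonormal:
  assumes "V = span {e1, e2, e3}" "norm e1 = 1" "norm e2 = 1" "norm e3 = 1"
     "e1 \<bullet> e2 = 0" "e1 \<bullet> e3 = 0" "e2 \<bullet> e3 = 0"
     "omega e1 e2 = 0" "omega e1 e3 = 0" "omega e2 e3 = 0" "Im (Omega e1 e2 e3) = 0"
  shows "special_lagrangian_plane V"
proof -
  have h: "herm e1 e2 = 0" "herm e1 e3 = 0" "herm e2 e3 = 0"
    using assms by (simp_all add: complex_eq_iff inner_herm omega_herm)
  have h': "herm e1 e1 = 1" "herm e2 e2 = 1" "herm e3 e3 = 1"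
    using assms by (simp_all add: herm_self)
  have h'': "herm e2 e1 = 0" "herm e3 e1 = 0" "herm e3 e2 = 0"
    using h cnj_herm [of e1 e2] cnj_herm [of e1 e3] cnj_herm [of e2 e3] by simp_all
  define X :: "complex^3^3" where "X = vector [e1, e2, e3]"
  define X' :: "complex^3^3" where "X' = (\<chi> i j. cnj (X $ i $ j))"
  have "X' ** transpose X = (\<chi> i j. herm (X $ i) (X $ j))"
    by (simp add: X'_def vec3_simps matrix_matrix_mult_def transpose_def herm_expand)
  also have "\<dots> = mat 1"
    by (simp add: X_def vec3_simps mat_def h h' h'')
  finally have "det X' * det X = 1"
    by (metis det_I det_mul det_transpose)
  moreover have "det X' = cnj (det X)"
    by (simp add: X'_def det_3)
  ultimately have "cnj (Omega e1 e2 e3) * Omega e1 e2 e3 = 1"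
    by (simp add: Omega_def X_def)
  then have "(Re (Omega e1 e2 e3))\<^sup>2 = 1"
    using assms(11) by (simp add: complex_eq_iff power2_eq_square)
  then consider "Re (Omega e1 e2 e3) = 1" | "Re (Omega e1 e2 e3) = - 1"
    by (auto simp: power2_eq_1_iff)
  then show ?thesis
  proof cases
    case 1
    then show ?thesis unfolding special_lagrangian_plane_def using assms by blast
  next
    case 2
    then have "Re (Omega e2 e1 e3) = 1"
      by (simp add: Omega_expand algebra_simps)
    moreover have "V = span {e2, e1, e3}" using assms(1) by (simp add: insert_commute)
    ultimately show ?thesis unfolding special_lagrangian_plane_def
      using assms by (metis inner_commute)
  qed
qed

lemma special_lagrangian_plane_range:
  fixes l :: "real^3 \<Rightarrow> complex^3"
  assumes l: "linear l" "inj l"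
    and om: "\<And>u v. omega (l u) (l v) = 0" and Om: "\<And>u v w. Im (Omega (l u) (l v) (l w)) = 0"
  shows "special_lagrangian_plane (range l)"
proof -
  have sub: "subspace (range l)" by (rule linear_subspace_image [OF l(1) subspace_UNIV])
  have "dim (range l) = dim (UNIV :: (real^3) set)"
    by (rule dim_image_eq [OF l(1)]) (use l(2) in simp)
  then have dim: "dim (range l) = 3" by simp
  from orthonormal_basis_subspace [OF sub] obtain B where B: "B \<subseteq> range l" "pairwise orthogonal B"
    "\<And>x. x \<in> B \<Longrightarrow> norm x = 1" "card B = dim (range l)" "span B = range l" by metis
  have "card B = 3" using B(4) dim by (rule trans)
  then obtain e1 e2 e3 where e: "B = {e1, e2, e3}" "e1 \<noteq> e2" "e2 \<noteq> e3" "e1 \<noteq> e3"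
    unfolding card_3_iff by blast
  have "e1 \<in> range l" "e2 \<in> range l" "e3 \<in> range l" using B(1) unfolding e(1) by simp_all
  then obtain u1 u2 u3 where u: "e1 = l u1" "e2 = l u2" "e3 = l u3" by (elim rangeE)
  show ?thesis
  proof (rule special_lagrangian_plane_orthonormal)
    show "range l = span {e1, e2, e3}" using B(5) e(1) by simp
    show "norm e1 = 1" "norm e2 = 1" "norm e3 = 1" using B(3) e(1) by auto
    show "e1 \<bullet> e2 = 0" "e1 \<bullet> e3 = 0" "e2 \<bullet> e3 = 0"
      using B(2) e by (auto simp: pairwise_def orthogonal_def)
  qed (simp_all add: u om Om)
qed

text \<open>If \<open>\<omega>\<close> or \<open>Im \<Omega>\<close> were nonzero on a tangent space of an immersion \<open>f\<close>, then by continuity also on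
  all nearby ones, but one of these is contained in the image of a differential of \<open>\<phi>\<close>.\<close>

lemma special_lagrangian_where_nonsingular_range:
  fixes \<phi> :: "real^3 \<Rightarrow> complex^3"
  assumes \<phi>: "\<And>y. (\<phi> has_derivative \<phi>' y) (at y)"
    and om: "\<And>y u v. omega (\<phi>' y u) (\<phi>' y v) = 0"
    and Om: "\<And>y u v w. Im (Omega (\<phi>' y u) (\<phi>' y v) (\<phi>' y w)) = 0"
  shows "special_lagrangian_where_nonsingular (range \<phi>)"
  unfolding special_lagrangian_where_nonsingular_def
proof (intro allI impI ballI)
  fix W f f' x
  assume "C1_immersion W f f' \<and> f ` W \<subseteq> range \<phi>" and x: "x \<in> W"
  then have W: "open W" and f: "\<And>x. x \<in> W \<Longrightarrow> (f has_derivative f' x) (at x)"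
    "\<And>x. x \<in> W \<Longrightarrow> inj (f' x)" and cont: "\<And>v. continuous_on W (\<lambda>x. f' x v)"
    and img: "f ` W \<subseteq> range \<phi>"
    by (auto simp: C1_immersion_def)
  have vanish: "c (f' x) = 0" if c: "continuous_on W (\<lambda>x. c (f' x))"
    and 0: "\<And>l y. range l \<subseteq> range (\<phi>' y) \<Longrightarrow> c l = 0" for c :: "(real^3 \<Rightarrow> complex^3) \<Rightarrow> real"
  proof (rule ccontr)
    assume "c (f' x) \<noteq> 0"
    define V where "V = {x \<in> W. c (f' x) \<in> - {0}}"
    have V: "open V" "x \<in> V" "V \<subseteq> W"
      unfolding V_def using continuous_openin_preimage_gen [OF c, of "- {0}"] W x \<open>c (f' x) \<noteq> 0\<close>
      by (auto simp: openin_open_eq vimage_def Int_def)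
    have "continuous_on V (\<lambda>x. f' x v)" for v
      using continuous_on_subset [OF cont V(3)] .
    moreover have "f ` V \<subseteq> range \<phi>" using img V(3) by blast
    ultimately obtain x' y where "x' \<in> V" "range (f' x') \<subseteq> range (\<phi>' y)"
      using tangent_space_within_image [OF \<phi> V(1,2), of f f'] V(3) f x by blast
    with 0 show False by (auto simp: V_def)
  qed
  have pick: "\<exists>s. l u = \<phi>' y s" if "range l \<subseteq> range (\<phi>' y)" for l y u
    using that by (metis (no_types, lifting) rangeE rangeI subsetD)
  show "special_lagrangian_plane (range (f' x))"
  proof (rule special_lagrangian_plane_range)
    show "linear (f' x)" "inj (f' x)" using f x has_derivative_linear by blast+
    show "omega (f' x u) (f' x v) = 0" for u v
    proof (rule vanish [of "\<lambda>l. omega (l u) (l v)"])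
      show "continuous_on W (\<lambda>x. omega (f' x u) (f' x v))"
        by (rule omega.continuous_on [OF cont cont])
      show "omega (l u) (l v) = 0" if "range l \<subseteq> range (\<phi>' y)" for l y
        using pick [OF that] om by metis
    qed
    show "Im (Omega (f' x u) (f' x v) (f' x w)) = 0" for u v w
    proof (rule vanish [of "\<lambda>l. Im (Omega (l u) (l v) (l w))"])
      have "continuous_on W (\<lambda>x. 2 * omega (f' x u \<otimes>\<^sub>c f' x v) (f' x w))"
        by (intro continuous_intros omega.continuous_on ccross.continuous_on cont)
      then show "continuous_on W (\<lambda>x. Im (Omega (f' x u) (f' x v) (f' x w)))"
        by (simp add: omega_ccross)
      show "Im (Omega (l u) (l v) (l w)) = 0" if "range l \<subseteq> range (\<phi>' y)" for l y
        using pick [OF that] Om by metis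
    qed
  qed
qed

section \<open>Evolutions of quadratic maps\<close>

text \<open>For \<open>\<phi> =\<close> \<open>quadratic_map\<close> below, these are the coefficients in \<open>y1\<close> and \<open>y2\<close> of
  \<open>\<omega>(\<partial>\<^sub>1\<phi>, \<partial>\<^sub>2\<phi>) = 0\<close> and of \<open>\<partial>\<^sub>t\<phi> = \<partial>\<^sub>1\<phi> \<times> \<partial>\<^sub>2\<phi>\<close>. Compared with the combinations
  \<open>(y1\<^sup>2 \<plusminus> y2\<^sup>2) / 2\<close>, the basis of monomials has the advantage that the degenerate case is \<open>R = 0\<close>.\<close>

definition quadratic_evolution where
  "quadratic_evolution P Q R L M K \<longleftrightarrow>
     (\<forall>t. omega (P t) (Q t) = 0 \<and> omega (P t) (R t) = 0 \<and> omega (Q t) (R t) = 0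
        \<and> 2 * omega (P t) (M t) + omega (L t) (Q t) = 0
        \<and> omega (Q t) (M t) + 2 * omega (L t) (R t) = 0
        \<and> omega (L t) (M t) = 0
        \<and> (P has_vector_derivative 2 *\<^sub>R (P t \<otimes>\<^sub>c Q t)) (at t)
        \<and> (Q has_vector_derivative 4 *\<^sub>R (P t \<otimes>\<^sub>c R t)) (at t)
        \<and> (R has_vector_derivative 2 *\<^sub>R (Q t \<otimes>\<^sub>c R t)) (at t)
        \<and> (L has_vector_derivative 2 *\<^sub>R (P t \<otimes>\<^sub>c M t) + L t \<otimes>\<^sub>c Q t) (at t)
        \<and> (M has_vector_derivative Q t \<otimes>\<^sub>c M t + 2 *\<^sub>R (L t \<otimes>\<^sub>c R t)) (at t)
        \<and> (K has_vector_derivative L t \<otimes>\<^sub>c M t) (at t))"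

definition quadratic_map where
  "quadratic_map P Q R L M K y1 y2 t =
     y1\<^sup>2 *\<^sub>R P t + (y1 * y2) *\<^sub>R Q t + y2\<^sup>2 *\<^sub>R R t + y1 *\<^sub>R L t + y2 *\<^sub>R M t + (K t :: complex^3)"

definition quadratic_fold where
  "quadratic_fold P Q R L M K = {quadratic_map P Q R L M K y1 y2 t | y1 y2 t. True}"

text \<open>Constraints at one time propagate: the derivative of each constraint is a combination of values of
  \<open>Im \<Omega>\<close> on the same three vectors in different orders, which cancel.\<close>

lemma quadratic_evolutionI:
  fixes P Q R L M K :: "real \<Rightarrow> complex^3"
  assumes init: "omega (P 0) (Q 0) = 0" "omega (P 0) (R 0) = 0" "omega (Q 0) (R 0) = 0"
      "2 * omega (P 0) (M 0) + omega (L 0) (Q 0) = 0"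
      "omega (Q 0) (M 0) + 2 * omega (L 0) (R 0) = 0"
      "omega (L 0) (M 0) = 0"
    and deriv: "\<And>t. (P has_vector_derivative 2 *\<^sub>R (P t \<otimes>\<^sub>c Q t)) (at t)"
      "\<And>t. (Q has_vector_derivative 4 *\<^sub>R (P t \<otimes>\<^sub>c R t)) (at t)"
      "\<And>t. (R has_vector_derivative 2 *\<^sub>R (Q t \<otimes>\<^sub>c R t)) (at t)"
      "\<And>t. (L has_vector_derivative 2 *\<^sub>R (P t \<otimes>\<^sub>c M t) + L t \<otimes>\<^sub>c Q t) (at t)"
      "\<And>t. (M has_vector_derivative Q t \<otimes>\<^sub>c M t + 2 *\<^sub>R (L t \<otimes>\<^sub>c R t)) (at t)"
      "\<And>t. (K has_vector_derivative L t \<otimes>\<^sub>c M t) (at t)"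
  shows "quadratic_evolution P Q R L M K"
proof -
  have const: "f t = 0" if "\<And>t. (f has_vector_derivative 0) (at t)" "f 0 = 0"
    for f :: "real \<Rightarrow> real" and t
    using has_derivative_zero_unique [of UNIV f 0 t] that
    by (auto simp: has_vector_derivative_def)
  note rules = has_vector_derivative_add has_vector_derivative_mult_right
    omega.has_vector_derivative deriv
  note simps = omega.add_left omega.add_right omega.scaleR_left omega.scaleR_right
    omega_ccross omega_ccross_right
  have "omega (P t) (Q t) = 0" for t
  proof (rule const [of "\<lambda>t. omega (P t) (Q t)"])
    show "((\<lambda>t. omega (P t) (Q t)) has_vector_derivative 0) (at t)" for t
      by (rule has_vector_derivative_eq_rhs, (rule rules)+)
        (simp add: simps
          Omega_permute [where a = "P t" and b = "Q t" and c = "R t"])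
  qed (rule init(1))
  moreover have "omega (P t) (R t) = 0" for t
  proof (rule const [of "\<lambda>t. omega (P t) (R t)"])
    show "((\<lambda>t. omega (P t) (R t)) has_vector_derivative 0) (at t)" for t
      by (rule has_vector_derivative_eq_rhs, (rule rules)+)
        (simp add: simps
          Omega_permute [where a = "P t" and b = "Q t" and c = "R t"])
  qed (rule init(2))
  moreover have "omega (Q t) (R t) = 0" for t
  proof (rule const [of "\<lambda>t. omega (Q t) (R t)"])
    show "((\<lambda>t. omega (Q t) (R t)) has_vector_derivative 0) (at t)" for t
      by (rule has_vector_derivative_eq_rhs, (rule rules)+)
        (simp add: simps
          Omega_permute [where a = "P t" and b = "Q t" and c = "R t"])
  qed (rule init(3))
  moreover have "2 * omega (P t) (M t) + omega (L t) (Q t) = 0" for t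
  proof (rule const [of "\<lambda>t. 2 * omega (P t) (M t) + omega (L t) (Q t)"])
    show "((\<lambda>t. 2 * omega (P t) (M t) + omega (L t) (Q t)) has_vector_derivative 0) (at t)" for t
      by (rule has_vector_derivative_eq_rhs, (rule rules)+)
        (simp add: simps
          Omega_permute [where a = "P t" and b = "Q t" and c = "M t"]
          Omega_permute [where a = "P t" and b = "R t" and c = "L t"])
  qed (rule init(4))
  moreover have "omega (Q t) (M t) + 2 * omega (L t) (R t) = 0" for t
  proof (rule const [of "\<lambda>t. omega (Q t) (M t) + 2 * omega (L t) (R t)"])
    show "((\<lambda>t. omega (Q t) (M t) + 2 * omega (L t) (R t)) has_vector_derivative 0) (at t)" for t
      by (rule has_vector_derivative_eq_rhs, (rule rules)+)
        (simp add: simps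
          Omega_permute [where a = "P t" and b = "R t" and c = "M t"]
          Omega_permute [where a = "L t" and b = "Q t" and c = "R t"])
  qed (rule init(5))
  moreover have "omega (L t) (M t) = 0" for t
  proof (rule const [of "\<lambda>t. omega (L t) (M t)"])
    show "((\<lambda>t. omega (L t) (M t)) has_vector_derivative 0) (at t)" for t
      by (rule has_vector_derivative_eq_rhs, (rule rules)+)
        (simp add: simps
          Omega_permute [where a = "P t" and b = "M t" and c = "L t"]
          Omega_permute [where a = "L t" and b = "Q t" and c = "M t"]
          Omega_permute [where a = "L t" and b = "R t" and c = "M t"])
  qed (rule init(6))
  ultimately show ?thesis
    using deriv by (auto simp: quadratic_evolution_def)
qed

lemma quadratic_evolutionD:
  assumes "quadratic_evolution P Q R L M K"
  shows "omega (P t) (Q t) = 0" "omega (P t) (R t) = 0" "omega (Q t) (R t) = 0"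
    "2 * omega (P t) (M t) + omega (L t) (Q t) = 0"
    "omega (Q t) (M t) + 2 * omega (L t) (R t) = 0"
    "omega (L t) (M t) = 0"
    "(P has_vector_derivative 2 *\<^sub>R (P t \<otimes>\<^sub>c Q t)) (at t)"
    "(Q has_vector_derivative 4 *\<^sub>R (P t \<otimes>\<^sub>c R t)) (at t)"
    "(R has_vector_derivative 2 *\<^sub>R (Q t \<otimes>\<^sub>c R t)) (at t)"
    "(L has_vector_derivative 2 *\<^sub>R (P t \<otimes>\<^sub>c M t) + L t \<otimes>\<^sub>c Q t) (at t)"
    "(M has_vector_derivative Q t \<otimes>\<^sub>c M t + 2 *\<^sub>R (L t \<otimes>\<^sub>c R t)) (at t)"
    "(K has_vector_derivative L t \<otimes>\<^sub>c M t) (at t)"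
  using assms unfolding quadratic_evolution_def by blast+

text \<open>The coefficient is the determinant of the real matrix of coefficients.\<close>

lemma Omega_linear_combinations:
  "Omega (u1 *\<^sub>R a + u2 *\<^sub>R b + u3 *\<^sub>R c) (v1 *\<^sub>R a + v2 *\<^sub>R b + v3 *\<^sub>R c)
     (w1 *\<^sub>R a + w2 *\<^sub>R b + w3 *\<^sub>R c) =
   complex_of_real (u1 * (v2 * w3 - v3 * w2) + u2 * (v3 * w1 - v1 * w3) + u3 * (v1 * w2 - v2 * w1))
     * Omega a b c"
proof -
  define C :: "complex^3^3" where "C = vector [vector [u1, u2, u3], vector [v1, v2, v3], vector [w1, w2, w3]]"
  have "(vector [u1 *\<^sub>R a + u2 *\<^sub>R b + u3 *\<^sub>R c, v1 *\<^sub>R a + v2 *\<^sub>R b + v3 *\<^sub>R c,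
      w1 *\<^sub>R a + w2 *\<^sub>R b + w3 *\<^sub>R c] :: complex^3^3) = C ** vector [a, b, c]"
    by (simp add: C_def vec3_simps matrix_matrix_mult_def scaleR_nth del: vector_scaleR_component)
  then show ?thesis
    by (simp add: Omega_def det_mul) (simp add: C_def det_3 algebra_simps)
qed

text \<open>The partial derivatives of the parametrization are \<open>A\<close>, \<open>B\<close> and \<open>A \<times> B\<close> with \<open>\<omega>(A, B) = 0\<close>.\<close>

lemma special_lagrangian_quadratic_fold:
  assumes E: "quadratic_evolution P Q R L M K"
  shows "special_lagrangian_where_nonsingular (quadratic_fold P Q R L M K)"
proof -
  define \<phi> where "\<phi> x = quadratic_map P Q R L M K (x$1) (x$2) (x$3)" for x :: "real^3"
  define A where "A x = (2 * x$1) *\<^sub>R P (x$3) + x$2 *\<^sub>R Q (x$3) + L (x$3)" for x :: "real^3"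
  define B where "B x = x$1 *\<^sub>R Q (x$3) + (2 * x$2) *\<^sub>R R (x$3) + M (x$3)" for x :: "real^3"
  define \<phi>' where "\<phi>' x v = v$1 *\<^sub>R A x + v$2 *\<^sub>R B x + v$3 *\<^sub>R (A x \<otimes>\<^sub>c B x)" for x v :: "real^3"
  note D = quadratic_evolutionD [OF E]
  have "quadratic_fold P Q R L M K = range \<phi>"
  proof -
    have "quadratic_map P Q R L M K y1 y2 t = \<phi> (vector [y1, y2, t])" for y1 y2 t
      by (simp add: \<phi>_def)
    then show ?thesis by (auto simp: quadratic_fold_def) (auto simp: \<phi>_def)
  qed
  moreover have "special_lagrangian_where_nonsingular (range \<phi>)"
  proof (rule special_lagrangian_where_nonsingular_range)
    fix x :: "real^3"
    have comp: "((\<lambda>x. f (x$3)) has_derivative (\<lambda>v. v$3 *\<^sub>R f')) (at x)"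
      if "(f has_vector_derivative f') (at (x$3))" for f :: "real \<Rightarrow> complex^3" and f'
    proof -
      have "((\<lambda>x :: real^3. x$3) has_derivative (\<lambda>v. v$3)) (at x)"
        by (rule bounded_linear_imp_has_derivative [OF bounded_linear_vec_nth])
      from has_derivative_compose [OF this that [unfolded has_vector_derivative_def]]
      show ?thesis .
    qed
    \<comment> \<open>Orienting all cross products in the same way lets linear normalisation finish the comparison.\<close>
    have sk: "M (x$3) \<otimes>\<^sub>c Q (x$3) = - (Q (x$3) \<otimes>\<^sub>c M (x$3))" "R (x$3) \<otimes>\<^sub>c Q (x$3) = - (Q (x$3) \<otimes>\<^sub>c R (x$3))"
      by (rule ccross_skew)+
    show "(\<phi> has_derivative \<phi>' x) (at x)"
      unfolding \<phi>_def [abs_def] quadratic_map_def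
      apply (rule has_derivative_eq_rhs)
       apply (rule derivative_intros bounded_linear_imp_has_derivative [OF bounded_linear_vec_nth] comp D)+
      apply (simp add: fun_eq_iff \<phi>'_def A_def B_def ccross.add_left ccross.add_right ccross.scaleR_left
         ccross.scaleR_right sk vec_eq_iff scaleR_nth power2_eq_square algebra_simps
         del: vector_scaleR_component)
      done
    have AB: "omega (A x) (B x) = 0"
    proof -
      have sk: "omega (L (x$3)) (R (x$3)) = - omega (Q (x$3)) (M (x$3)) / 2"
         "omega (L (x$3)) (Q (x$3)) = - 2 * omega (P (x$3)) (M (x$3))"
        using D(4,5) [of "x$3"] by simp_all
      show ?thesis
        by (simp add: A_def B_def omega.add_left omega.add_right omega.scaleR_left omega.scaleR_right
          D(1-3,6) sk)
    qed
    then have BA: "omega (B x) (A x) = 0" using omega_skew [of "B x"] by simp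
    show "omega (\<phi>' x u) (\<phi>' x v) = 0" for u v
      by (simp add: \<phi>'_def omega.add_left omega.add_right omega.scaleR_left omega.scaleR_right
          AB BA omega_ccross_self)
    show "Im (Omega (\<phi>' x u) (\<phi>' x v) (\<phi>' x w)) = 0" for u v w
      unfolding \<phi>'_def Omega_linear_combinations Omega_ccross of_real_mult [symmetric]
      by (rule Im_complex_of_real)
  qed
  ultimately show ?thesis by simp
qed

section \<open>Changes of parameters and unitary maps\<close>

lemma has_vector_derivative_time_scale:
  assumes "(f has_vector_derivative f') (at (d * t))"
  shows "((\<lambda>t. f (d * t)) has_vector_derivative d *\<^sub>R f') (at t)"
proof -
  have "((\<lambda>t. d * t) has_vector_derivative d) (at t)"
    by (auto intro!: derivative_eq_intros simp: has_real_derivative_iff_has_vector_derivative [symmetric])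
  from vector_diff_chain_at [OF this assms] show ?thesis by (simp add: o_def)
qed

text \<open>Under \<open>(y1, y2) \<mapsto> (a y1 + b y2, c y1 + e y2)\<close> both \<open>\<partial>\<^sub>1\<phi> \<times> \<partial>\<^sub>2\<phi>\<close> and \<open>\<omega>(\<partial>\<^sub>1\<phi>, \<partial>\<^sub>2\<phi>)\<close> get
  multiplied by the determinant \<open>d\<close>, since they are alternating. Hence time has to run with speed
  \<open>d\<close>.\<close>

lemma quadratic_evolution_linear_change:
  assumes E: "quadratic_evolution P Q R L M K" and d: "d = a * e - b * c"
  shows "quadratic_evolution
    (\<lambda>t. a\<^sup>2 *\<^sub>R P (d * t) + (a * c) *\<^sub>R Q (d * t) + c\<^sup>2 *\<^sub>R R (d * t))
    (\<lambda>t. (2 * a * b) *\<^sub>R P (d * t) + (a * e + b * c) *\<^sub>R Q (d * t) + (2 * c * e) *\<^sub>R R (d * t))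
    (\<lambda>t. b\<^sup>2 *\<^sub>R P (d * t) + (b * e) *\<^sub>R Q (d * t) + e\<^sup>2 *\<^sub>R R (d * t))
    (\<lambda>t. a *\<^sub>R L (d * t) + c *\<^sub>R M (d * t))
    (\<lambda>t. b *\<^sub>R L (d * t) + e *\<^sub>R M (d * t))
    (\<lambda>t. K (d * t))"
proof -
  note bil = omega.add_left omega.add_right omega.scaleR_left omega.scaleR_right
  note D = quadratic_evolutionD [OF E]
  have skew: "omega (Q s) (P s) = 0" "omega (R s) (P s) = 0" "omega (R s) (Q s) = 0"
      "omega (M s) (L s) = 0"
      "omega (L s) (Q s) = - 2 * omega (P s) (M s)" "omega (Q s) (M s) = - 2 * omega (L s) (R s)"
      "omega (L s) (P s) = - omega (P s) (L s)" "omega (M s) (P s) = - omega (P s) (M s)"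
      "omega (Q s) (L s) = 2 * omega (P s) (M s)" "omega (M s) (Q s) = 2 * omega (L s) (R s)"
      "omega (R s) (L s) = - omega (L s) (R s)" "omega (R s) (M s) = - omega (M s) (R s)" for s
    using D(1-6) [of s] omega_skew [of "Q s" "P s"] omega_skew [of "R s" "P s"]
      omega_skew [of "R s" "Q s"] omega_skew [of "M s" "L s"] omega_skew [of "L s" "P s"]
      omega_skew [of "M s" "P s"] omega_skew [of "Q s" "L s"] omega_skew [of "M s" "Q s"]
      omega_skew [of "R s" "L s"] omega_skew [of "R s" "M s"] by linarith+
  note T = D(7-12) [THEN has_vector_derivative_time_scale]
  note rules = has_vector_derivative_eq_rhs has_vector_derivative_add
    bounded_linear.has_vector_derivative [OF bounded_linear_scaleR_right] T
  have cskew: "Q s \<otimes>\<^sub>c P s = - (P s \<otimes>\<^sub>c Q s)" "R s \<otimes>\<^sub>c P s = - (P s \<otimes>\<^sub>c R s)"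
    "R s \<otimes>\<^sub>c Q s = - (Q s \<otimes>\<^sub>c R s)" "L s \<otimes>\<^sub>c P s = - (P s \<otimes>\<^sub>c L s)"
    "M s \<otimes>\<^sub>c P s = - (P s \<otimes>\<^sub>c M s)" "Q s \<otimes>\<^sub>c L s = - (L s \<otimes>\<^sub>c Q s)"
    "M s \<otimes>\<^sub>c Q s = - (Q s \<otimes>\<^sub>c M s)" "R s \<otimes>\<^sub>c L s = - (L s \<otimes>\<^sub>c R s)"
    "M s \<otimes>\<^sub>c R s = - (R s \<otimes>\<^sub>c M s)" "M s \<otimes>\<^sub>c L s = - (L s \<otimes>\<^sub>c M s)" for s
    by (rule ccross_skew)+
  note comps = ccross.add_left ccross.add_right ccross.scaleR_left ccross.scaleR_right cskew ccross_self
    vec_eq_iff scaleR_nth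
  show ?thesis
    unfolding quadratic_evolution_def
    apply (intro allI conjI)
               apply (simp_all only: bil skew D omega_self)
               apply (simp_all add: algebra_simps power2_eq_square)[6]
    subgoal by (rule has_vector_derivative_eq_rhs, (rule rules(2-))+)
        (simp add: comps d algebra_simps power2_eq_square del: vector_scaleR_component)
    subgoal by (rule has_vector_derivative_eq_rhs, (rule rules(2-))+)
        (simp add: comps d algebra_simps power2_eq_square del: vector_scaleR_component)
    subgoal by (rule has_vector_derivative_eq_rhs, (rule rules(2-))+)
        (simp add: comps d algebra_simps power2_eq_square del: vector_scaleR_component)
    subgoal by (rule has_vector_derivative_eq_rhs, (rule rules(2-))+)
        (simp add: comps d algebra_simps power2_eq_square del: vector_scaleR_component)
    subgoal by (rule has_vector_derivative_eq_rhs, (rule rules(2-))+)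
        (simp add: comps d algebra_simps power2_eq_square del: vector_scaleR_component)
    subgoal by (rule has_vector_derivative_eq_rhs, (rule rules(2-))+)
        (simp add: comps d algebra_simps power2_eq_square del: vector_scaleR_component)
    done
qed

text \<open>This is the translation \<open>(y1, y2) \<mapsto> (y1 + h, y2 + k)\<close>.\<close>

lemma quadratic_evolution_shift:
  assumes E: "quadratic_evolution P Q R L M K"
  shows "quadratic_evolution P Q R
    (\<lambda>t. L t + (2 * h) *\<^sub>R P t + k *\<^sub>R Q t) (\<lambda>t. M t + h *\<^sub>R Q t + (2 * k) *\<^sub>R R t)
    (\<lambda>t. K t + h *\<^sub>R L t + k *\<^sub>R M t + h\<^sup>2 *\<^sub>R P t + (h * k) *\<^sub>R Q t + k\<^sup>2 *\<^sub>R R t)"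
proof -
  note bil = omega.add_left omega.add_right omega.scaleR_left omega.scaleR_right
  note D = quadratic_evolutionD [OF E]
  have skew: "omega (Q s) (P s) = 0" "omega (R s) (P s) = 0" "omega (R s) (Q s) = 0"
      "omega (M s) (L s) = 0"
      "omega (L s) (Q s) = - 2 * omega (P s) (M s)" "omega (Q s) (M s) = - 2 * omega (L s) (R s)"
      for s
    using D(1-6) [of s] omega_skew [of "Q s" "P s"] omega_skew [of "R s" "P s"]
      omega_skew [of "R s" "Q s"] omega_skew [of "M s" "L s"]  by linarith+
  note rules = has_vector_derivative_eq_rhs has_vector_derivative_add
    bounded_linear.has_vector_derivative [OF bounded_linear_scaleR_right] D(7-12)
  have cskew: "Q s \<otimes>\<^sub>c P s = - (P s \<otimes>\<^sub>c Q s)" "R s \<otimes>\<^sub>c P s = - (P s \<otimes>\<^sub>c R s)"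
    "R s \<otimes>\<^sub>c Q s = - (Q s \<otimes>\<^sub>c R s)" "L s \<otimes>\<^sub>c P s = - (P s \<otimes>\<^sub>c L s)"
    "M s \<otimes>\<^sub>c P s = - (P s \<otimes>\<^sub>c M s)" "Q s \<otimes>\<^sub>c L s = - (L s \<otimes>\<^sub>c Q s)"
    "M s \<otimes>\<^sub>c Q s = - (Q s \<otimes>\<^sub>c M s)" "R s \<otimes>\<^sub>c L s = - (L s \<otimes>\<^sub>c R s)"
    "M s \<otimes>\<^sub>c R s = - (R s \<otimes>\<^sub>c M s)" "M s \<otimes>\<^sub>c L s = - (L s \<otimes>\<^sub>c M s)" for s
    by (rule ccross_skew)+
  note comps = ccross.add_left ccross.add_right ccross.scaleR_left ccross.scaleR_right cskew ccross_self
    vec_eq_iff scaleR_nth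
  show ?thesis
    unfolding quadratic_evolution_def
    apply (intro allI conjI)
               apply (simp_all only: bil skew D omega_self)
               apply (simp_all add: algebra_simps power2_eq_square)[3]
    subgoal by (rule has_vector_derivative_eq_rhs, (rule rules(2-))+)
        (simp add: comps algebra_simps power2_eq_square del: vector_scaleR_component)
    subgoal by (rule has_vector_derivative_eq_rhs, (rule rules(2-))+)
        (simp add: comps algebra_simps power2_eq_square del: vector_scaleR_component)
    subgoal by (rule has_vector_derivative_eq_rhs, (rule rules(2-))+)
        (simp add: comps algebra_simps power2_eq_square del: vector_scaleR_component)
    done
qed

lemma quadratic_fold_linear_change:
  fixes a b c d e :: real
  assumes d: "d = a * e - b * c" "d \<noteq> 0"
  shows "quadratic_fold
    (\<lambda>t. a\<^sup>2 *\<^sub>R P (d * t) + (a * c) *\<^sub>R Q (d * t) + c\<^sup>2 *\<^sub>R R (d * t))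
    (\<lambda>t. (2 * a * b) *\<^sub>R P (d * t) + (a * e + b * c) *\<^sub>R Q (d * t) + (2 * c * e) *\<^sub>R R (d * t))
    (\<lambda>t. b\<^sup>2 *\<^sub>R P (d * t) + (b * e) *\<^sub>R Q (d * t) + e\<^sup>2 *\<^sub>R R (d * t))
    (\<lambda>t. a *\<^sub>R L (d * t) + c *\<^sub>R M (d * t))
    (\<lambda>t. b *\<^sub>R L (d * t) + e *\<^sub>R M (d * t))
    (\<lambda>t. K (d * t)) = quadratic_fold P Q R L M K" (is "?X = ?Y")
proof -
  have eq: "quadratic_map
    (\<lambda>t. a\<^sup>2 *\<^sub>R P (d * t) + (a * c) *\<^sub>R Q (d * t) + c\<^sup>2 *\<^sub>R R (d * t))
    (\<lambda>t. (2 * a * b) *\<^sub>R P (d * t) + (a * e + b * c) *\<^sub>R Q (d * t) + (2 * c * e) *\<^sub>R R (d * t))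
    (\<lambda>t. b\<^sup>2 *\<^sub>R P (d * t) + (b * e) *\<^sub>R Q (d * t) + e\<^sup>2 *\<^sub>R R (d * t))
    (\<lambda>t. a *\<^sub>R L (d * t) + c *\<^sub>R M (d * t))
    (\<lambda>t. b *\<^sub>R L (d * t) + e *\<^sub>R M (d * t))
    (\<lambda>t. K (d * t)) y1 y2 t = quadratic_map P Q R L M K (a * y1 + b * y2) (c * y1 + e * y2) (d * t)"
    for y1 y2 t
    by (simp add: quadratic_map_def power2_eq_square algebra_simps)
  show ?thesis
  proof
    show "?X \<subseteq> ?Y" by (auto simp: quadratic_fold_def eq)
    show "?Y \<subseteq> ?X"
    proof
      fix x assume "x \<in> ?Y"
      then obtain y1 y2 t where x: "x = quadratic_map P Q R L M K y1 y2 t"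
        by (auto simp: quadratic_fold_def)
      have "a * ((e * y1 - b * y2) / d) + b * ((a * y2 - c * y1) / d) = (a * e - b * c) * y1 / d"
        by (simp add: field_simps add_divide_distrib diff_divide_distrib)
      moreover have "c * ((e * y1 - b * y2) / d) + e * ((a * y2 - c * y1) / d) = (a * e - b * c) * y2 / d"
        by (simp add: field_simps add_divide_distrib diff_divide_distrib)
      moreover have "d * (t / d) = t" using d(2) by simp
      ultimately show "x \<in> ?X"
        using d unfolding quadratic_fold_def mem_Collect_eq eq x
        by (intro exI [of _ "(e * y1 - b * y2) / d"] exI [of _ "(a * y2 - c * y1) / d"] exI [of _ "t / d"]) simp
    qed
  qed
qed

lemma quadratic_fold_shift:
  "quadratic_fold P Q R
    (\<lambda>t. L t + (2 * h) *\<^sub>R P t + k *\<^sub>R Q t) (\<lambda>t. M t + h *\<^sub>R Q t + (2 * k) *\<^sub>R R t)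
    (\<lambda>t. K t + h *\<^sub>R L t + k *\<^sub>R M t + h\<^sup>2 *\<^sub>R P t + (h * k) *\<^sub>R Q t + k\<^sup>2 *\<^sub>R R t)
   = quadratic_fold P Q R L M K" (is "?X = ?Y")
proof -
  have eq: "quadratic_map P Q R
    (\<lambda>t. L t + (2 * h) *\<^sub>R P t + k *\<^sub>R Q t) (\<lambda>t. M t + h *\<^sub>R Q t + (2 * k) *\<^sub>R R t)
    (\<lambda>t. K t + h *\<^sub>R L t + k *\<^sub>R M t + h\<^sup>2 *\<^sub>R P t + (h * k) *\<^sub>R Q t + k\<^sup>2 *\<^sub>R R t) y1 y2 t
    = quadratic_map P Q R L M K (y1 + h) (y2 + k) t" for y1 y2 t
    by (simp add: quadratic_map_def vec_eq_iff scaleR_nth power2_eq_square algebra_simps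
        del: vector_scaleR_component)
  have "quadratic_map P Q R L M K y1 y2 t \<in> ?X" for y1 y2 t
    unfolding quadratic_fold_def mem_Collect_eq eq
    by (intro exI [of _ "y1 - h"] exI [of _ "y2 - k"] exI [of _ t]) simp
  then show ?thesis
    by (auto simp: quadratic_fold_def eq)
qed

lemma quadratic_evolution_special_unitary:
  assumes U: "special_unitary U" and E: "quadratic_evolution P Q R L M K"
  shows "quadratic_evolution (\<lambda>t. U *v P t) (\<lambda>t. U *v Q t) (\<lambda>t. U *v R t)
    (\<lambda>t. U *v L t) (\<lambda>t. U *v M t) (\<lambda>t. U *v K t)"
proof -
  interpret U: bounded_linear "(*v) U" by (rule matrix_vector_mul_bounded_linear)
  note der = quadratic_evolutionD(7-12) [OF E, THEN U.has_vector_derivative]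
  have "omega (U *v u) (U *v v) = omega u v" for u v
    by (simp add: omega_herm herm_special_unitary [OF U])
  then show ?thesis
    using der quadratic_evolutionD(1-6) [OF E]
    unfolding quadratic_evolution_def
    by (simp add: U.add U.scaleR ccross_special_unitary [OF U])
qed

lemma quadratic_fold_affine:
  "(\<lambda>v. U *v v + b) ` quadratic_fold P Q R L M K =
   quadratic_fold (\<lambda>t. U *v P t) (\<lambda>t. U *v Q t) (\<lambda>t. U *v R t)
    (\<lambda>t. U *v L t) (\<lambda>t. U *v M t) (\<lambda>t. U *v K t + b)"
proof -
  interpret U: bounded_linear "(*v) U" by (rule matrix_vector_mul_bounded_linear)
  have "U *v quadratic_map P Q R L M K y1 y2 t + b =
    quadratic_map (\<lambda>t. U *v P t) (\<lambda>t. U *v Q t) (\<lambda>t. U *v R t)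
    (\<lambda>t. U *v L t) (\<lambda>t. U *v M t) (\<lambda>t. U *v K t + b) y1 y2 t" for y1 y2 t
    by (simp add: quadratic_map_def U.add U.scaleR)
  then show ?thesis by (auto simp: quadratic_fold_def image_iff) metis+
qed

section \<open>Uniqueness of solutions\<close>

lemma norm_constant:
  fixes f :: "real \<Rightarrow> 'a::real_inner"
  assumes "\<And>t. (f has_vector_derivative f' t) (at t)" "\<And>t. f t \<bullet> f' t = 0"
  shows "norm (f t) = norm (f s)"
proof -
  have "((\<lambda>t. f t \<bullet> f t) has_vector_derivative 0) (at t)" for t
    using bounded_bilinear.has_vector_derivative [OF bounded_bilinear_inner assms(1) assms(1), of t]
      assms(2) [of t] by (simp add: inner_commute)
  then have "f t \<bullet> f t = f s \<bullet> f s"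
    using has_derivative_zero_unique [of UNIV "\<lambda>t. f t \<bullet> f t" s t]
    by (auto simp: has_vector_derivative_def)
  then show ?thesis by (simp add: norm_eq_sqrt_inner)
qed

text \<open>For the evolution equations this replaces the general uniqueness theorem for differential
  equations: the derivative of the difference \<open>x\<close> of two solutions is a real multiple of \<open>x \<times> u\<close> for
  some vector \<open>u\<close>, and so orthogonal to \<open>x\<close>.\<close>

lemma eq_of_derivative_difference_orthogonal:
  fixes f g :: "real \<Rightarrow> 'a::real_inner"
  assumes "\<And>t. (f has_vector_derivative f' t) (at t)" "\<And>t. (g has_vector_derivative g' t) (at t)"
    "\<And>t. (f t - g t) \<bullet> (f' t - g' t) = 0" "f s = g s"
  shows "f t = g t"
proof -
  have "norm (f t - g t) = norm (f s - g s)"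
    by (rule norm_constant [of "\<lambda>t. f t - g t"]) (use assms has_vector_derivative_diff in blast)+
  then show ?thesis using assms(4) by simp
qed

text \<open>The functions have to be compared in the order \<open>P\<close>, \<open>M\<close>, \<open>L\<close>, \<open>K\<close>: with \<open>R = 0\<close> and \<open>Q\<close> constant,
  each of the equations is linear in its unknown and involves only the earlier ones as coefficients
  and inhomogeneity. The function \<open>K\<close> is an integral, and is determined up to a translation.\<close>

lemma quadratic_evolution_unique:
  assumes E: "quadratic_evolution P (\<lambda>_. q) (\<lambda>_. 0) L M K"
    and E': "quadratic_evolution P' (\<lambda>_. q) (\<lambda>_. 0) L' M' K'"
    and init: "P 0 = P' 0" "L 0 = L' 0" "M 0 = M' 0"
  shows "P = P'" "L = L'" "M = M'" "K t = K' t + (K 0 - K' 0)"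
proof -
  note D = quadratic_evolutionD [OF E] and D' = quadratic_evolutionD [OF E']
  have "P t = P' t" for t
    by (rule eq_of_derivative_difference_orthogonal [OF D(7) D'(7) _ init(1)])
      (simp add: inner_ccross_self flip: scaleR_diff_right ccross.diff_left)
  then show P: "P = P'" by blast
  have "M t = M' t" for t
    by (rule eq_of_derivative_difference_orthogonal [OF D(11) D'(11) _ init(3)])
      (simp add: inner_ccross_self ccross.zero_right flip: ccross.diff_right)
  then show M: "M = M'" by blast
  have "L t = L' t" for t
    by (rule eq_of_derivative_difference_orthogonal [OF D(10) D'(10) _ init(2)])
      (simp add: P M inner_ccross_self flip: ccross.diff_left)
  then show L: "L = L'" by blast
  have "K t - K' t = K 0 - K' 0"
    by (rule eq_of_derivative_difference_orthogonal
         [OF has_vector_derivative_diff [OF D(12) D'(12)] has_vector_derivative_const])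
      (simp_all add: L M)
  then show "K t = K' t + (K 0 - K' 0)" by (simp add: algebra_simps)
qed

section \<open>The explicit solutions\<close>

definition family_P :: "real \<Rightarrow> complex^3" where
  "family_P t = vector [cis t, - \<i> * cis (-t), 0]"

definition family_Q :: "complex^3" where
  "family_Q = vector [0, 0, 1]"

definition family_L :: "complex \<Rightarrow> complex \<Rightarrow> complex \<Rightarrow> complex \<Rightarrow> real \<Rightarrow> complex^3" where
  "family_L A B D E t = vector
     [D * cis (t/2) + E * cis (-t/2),
      \<i> * (- cnj D * cis (-t/2) + cnj E * cis (t/2)),
      2 * A * cis (-t/2) - 2 * cnj A * cis (t/2)
        - 2/3 * B * cis (-3*t/2) - 2/3 * cnj B * cis (3*t/2)]"

definition family_M :: "complex \<Rightarrow> complex \<Rightarrow> real \<Rightarrow> complex^3" where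
  "family_M A B t = vector
     [A * cis (t/2) + B * cis (-t/2), \<i> * (cnj A * cis (-t/2) - cnj B * cis (t/2)), 0]"

definition family_K :: "complex \<Rightarrow> complex \<Rightarrow> complex \<Rightarrow> complex \<Rightarrow> real \<Rightarrow> complex^3" where
  "family_K A B D E t = vector [zeta1 A B D E 0 0 t, zeta2 A B D E 0 0 t, zeta3 A B D E 0 0 t]"

lemma family_fold_quadratic:
  "family_fold A B D E = quadratic_fold family_P (\<lambda>_. family_Q) (\<lambda>_. 0)
     (family_L A B D E) (family_M A B) (family_K A B D E)"
proof -
  have "vector [zeta1 A B D E y1 y2 t, zeta2 A B D E y1 y2 t, zeta3 A B D E y1 y2 t] =
     quadratic_map family_P (\<lambda>_. family_Q) (\<lambda>_. 0)
     (family_L A B D E) (family_M A B) (family_K A B D E) y1 y2 t" for y1 y2 t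
    by (simp add: quadratic_map_def family_P_def family_Q_def family_L_def family_M_def family_K_def
      zeta1_def zeta2_def zeta3_def vec3_simps scaleR_nth algebra_simps del: vector_scaleR_component)
  then show ?thesis by (simp add: family_fold_def quadratic_fold_def)
qed

lemma has_vector_derivative_vector3:
  fixes f1 f2 f3 :: "real \<Rightarrow> complex"
  assumes "(f1 has_vector_derivative d1) (at t)" "(f2 has_vector_derivative d2) (at t)"
    "(f3 has_vector_derivative d3) (at t)"
  shows "((\<lambda>t. vector [f1 t, f2 t, f3 t] :: complex^3) has_vector_derivative vector [d1, d2, d3]) (at t)"
proof -
  have "(\<lambda>t. vector [f1 t, f2 t, f3 t] :: complex^3) = (\<lambda>t. axis 1 (f1 t) + axis 2 (f2 t) + axis 3 (f3 t))"
    "(vector [d1, d2, d3] :: complex^3) = axis 1 d1 + axis 2 d2 + axis 3 d3"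
    by (simp_all add: fun_eq_iff vec3_simps axis_def)
  moreover have bl: "bounded_linear (axis i :: complex \<Rightarrow> complex^3)" for i
    unfolding linear_conv_bounded_linear [symmetric]
    by (rule linearI) (simp_all add: axis_def vec_eq_iff)
  have "((\<lambda>t. axis 1 (f1 t) + axis 2 (f2 t) + axis 3 (f3 t) :: complex^3) has_vector_derivative
      axis 1 d1 + axis 2 d2 + axis 3 d3) (at t)"
    by (intro has_vector_derivative_add bounded_linear.has_vector_derivative [OF bl] assms)
  ultimately show ?thesis by simp
qed

lemma has_vector_derivative_cis:
  assumes "(g has_vector_derivative g') (at t)"
  shows "((\<lambda>t. cis (g t)) has_vector_derivative (\<i> * g' * cis (g t))) (at t)"
  using assms has_derivative_cis [of g "\<lambda>s. s *\<^sub>R g'" t UNIV]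
  by (simp add: has_vector_derivative_def scaleR_conv_of_real mult_ac)

text \<open>With \<open>w = cis (t/2)\<close> and its inverse \<open>v\<close>, the evolution equations of the explicit family become
  polynomial identities modulo \<open>w v = 1\<close>.\<close>

lemma cis_half:
  "cis t = cis (t/2) ^ 2" "cis (-t) = cis (-t/2) ^ 2" "cis (2*t) = cis (t/2) ^ 4"
  "cis (-2*t) = cis (-t/2) ^ 4" "cis (3*t/2) = cis (t/2) ^ 3" "cis (-3*t/2) = cis (-t/2) ^ 3"
  by (simp_all add: Complex.DeMoivre)

lemma quadratic_evolution_family:
  assumes "Im (A * cnj D + B * cnj E) = 0"
  shows "quadratic_evolution family_P (\<lambda>_. family_Q) (\<lambda>_. 0)
     (family_L A B D E) (family_M A B) (family_K A B D E)"
proof (rule quadratic_evolutionI)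
  note defs = family_P_def family_Q_def family_L_def family_M_def family_K_def
  show "omega (family_P 0) family_Q = 0"
    by (simp add: omega_herm herm_expand defs vec3_simps)
  show "omega (family_P 0) 0 = 0" "omega family_Q 0 = 0"
    by (simp_all add: omega.zero_right)
  show "2 * omega (family_P 0) (family_M A B 0) + omega (family_L A B D E 0) family_Q = 0"
    by (simp add: omega_herm herm_expand defs vec3_simps)
  show "omega family_Q (family_M A B 0) + 2 * omega (family_L A B D E 0) 0 = 0"
    by (simp add: omega_herm herm_expand defs vec3_simps)
  show "omega (family_L A B D E 0) (family_M A B 0) = 0"
    using assms by (simp add: omega_herm herm_expand defs vec3_simps algebra_simps)
  fix t
  define w v where "w = cis (t/2)" and "v = cis (-t/2)"
  have wv: "w * v = 1" "v * w = 1" by (simp_all add: w_def v_def cis_mult)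
  have cnj: "cnj w = v" "cnj v = w" by (simp_all add: w_def v_def cis_cnj)
  have wv2: "w * (v * x) = x" "v * (w * x) = x" for x
    using wv by (simp_all flip: mult.assoc)
  have Re: "complex_of_real (Re z) = (z + cnj z) / 2" for z
    by (simp add: complex_eq_iff)
  note cis = cis_half [of t, folded w_def v_def] w_def [symmetric] v_def [symmetric]
  have lin: "((\<lambda>t. t) has_vector_derivative 1) (at t)" "((\<lambda>t. - t) has_vector_derivative - 1) (at t)"
      "((\<lambda>t. c * t) has_vector_derivative c) (at t)"
      "((\<lambda>t. t / 2) has_vector_derivative 1 / 2) (at t)"
      "((\<lambda>t. - t / 2) has_vector_derivative - 1 / 2) (at t)"
      "((\<lambda>t. c * t / 2) has_vector_derivative c / 2) (at t)" for c t :: real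
    by (auto intro!: derivative_eq_intros simp: has_real_derivative_iff_has_vector_derivative [symmetric])
  have ct: "((\<lambda>t. c * complex_of_real t) has_vector_derivative c) (at t)" for c t
    using has_vector_derivative_mult_right
      [OF bounded_linear.has_vector_derivative [OF bounded_linear_of_real lin(1)], of c t]
    by simp
  note rules = has_vector_derivative_vector3 has_vector_derivative_add has_vector_derivative_diff
    ct has_vector_derivative_mult_right has_vector_derivative_cis lin has_vector_derivative_const
  note comps = vec3_simps ccross_nth scaleR_nth
  show "(family_P has_vector_derivative 2 *\<^sub>R (family_P t \<otimes>\<^sub>c family_Q)) (at t)"
    unfolding defs [abs_def]
    apply (rule has_vector_derivative_eq_rhs, (rule rules)+)
    apply (simp add: comps cis_cnj del: vector_scaleR_component)
    done
  show "((\<lambda>_. family_Q) has_vector_derivative 4 *\<^sub>R (family_P t \<otimes>\<^sub>c 0)) (at t)"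
    "((\<lambda>_. 0) has_vector_derivative 2 *\<^sub>R (family_Q \<otimes>\<^sub>c 0)) (at t)"
    by (simp_all add: ccross.zero_right)
  show "(family_L A B D E has_vector_derivative
     2 *\<^sub>R (family_P t \<otimes>\<^sub>c family_M A B t) + family_L A B D E t \<otimes>\<^sub>c family_Q) (at t)"
    unfolding defs [abs_def]
    apply (rule has_vector_derivative_eq_rhs, (rule rules)+)
    apply (simp only: cis)
    apply (simp add: comps cnj del: vector_scaleR_component)
    apply (simp add: field_simps wv wv2 power2_eq_square power3_eq_cube)
    done
  show "(family_M A B has_vector_derivative
     family_Q \<otimes>\<^sub>c family_M A B t + 2 *\<^sub>R (family_L A B D E t \<otimes>\<^sub>c 0)) (at t)"
    unfolding defs [abs_def] ccross.zero_right
    apply (rule has_vector_derivative_eq_rhs, (rule rules)+)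
    apply (simp only: cis)
    apply (simp add: comps cnj del: vector_scaleR_component)
    apply (simp add: field_simps wv wv2 power2_eq_square power3_eq_cube)
    done
  show "(family_K A B D E has_vector_derivative family_L A B D E t \<otimes>\<^sub>c family_M A B t) (at t)"
    unfolding defs [abs_def] zeta1_def zeta2_def zeta3_def
    apply (rule has_vector_derivative_eq_rhs, (rule rules)+)
    apply (simp only: cis Re)
    apply (simp add: comps cnj del: vector_scaleR_component)
    apply (simp add: field_simps wv wv2 power2_eq_square power3_eq_cube power4_eq_xxxx)
    done
qed

section \<open>Data spanning a plane\<close>

lemma quadratic_evolution_construction_data:
  assumes "construction_data z1 z2 z3 z4 z5 z6"
  shows "quadratic_evolution (\<lambda>t. (1/2) *\<^sub>R (z1 t + z2 t)) z3 (\<lambda>t. (1/2) *\<^sub>R (z1 t - z2 t)) z4 z5 z6"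
proof -
  note D = assms [unfolded construction_data_def]
  have om: "omega (z3 0) (z1 0) = 0" "omega (z3 0) (z2 0) = 0" "omega (z2 0) (z1 0) = 0"
    "omega (z4 0) (z1 0) = - omega (z1 0) (z4 0)" "omega (z4 0) (z2 0) = - omega (z2 0) (z4 0)"
    "omega (z4 0) (z3 0) = - omega (z3 0) (z4 0)"
    using D omega_skew [of "z3 0" "z1 0"] omega_skew [of "z3 0" "z2 0"] omega_skew [of "z2 0" "z1 0"]
      omega_skew [of "z4 0"] by auto
  have cs: "z3 t \<otimes>\<^sub>c z1 t = - (z1 t \<otimes>\<^sub>c z3 t)" "z3 t \<otimes>\<^sub>c z2 t = - (z2 t \<otimes>\<^sub>c z3 t)"
    "z2 t \<otimes>\<^sub>c z1 t = - (z1 t \<otimes>\<^sub>c z2 t)" "z4 t \<otimes>\<^sub>c z1 t = - (z1 t \<otimes>\<^sub>c z4 t)"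
    "z4 t \<otimes>\<^sub>c z2 t = - (z2 t \<otimes>\<^sub>c z4 t)" "z4 t \<otimes>\<^sub>c z3 t = - (z3 t \<otimes>\<^sub>c z4 t)" for t
    by (rule ccross_skew)+
  note bil = omega.add_left omega.add_right omega.diff_left omega.diff_right
    omega.scaleR_left omega.scaleR_right om
  note cbil = ccross.add_left ccross.add_right ccross.diff_left ccross.diff_right
    ccross.scaleR_left ccross.scaleR_right cs
  have d: "(z1 has_vector_derivative 2 *\<^sub>R (z2 t \<otimes>\<^sub>c z3 t)) (at t)"
    "(z2 has_vector_derivative 2 *\<^sub>R (z1 t \<otimes>\<^sub>c z3 t)) (at t)"
    "(z3 has_vector_derivative (-2) *\<^sub>R (z1 t \<otimes>\<^sub>c z2 t)) (at t)"
    "(z4 has_vector_derivative (z1 t \<otimes>\<^sub>c z5 t) + (z2 t \<otimes>\<^sub>c z5 t) - (z3 t \<otimes>\<^sub>c z4 t)) (at t)"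
    "(z5 has_vector_derivative - (z1 t \<otimes>\<^sub>c z4 t) + (z2 t \<otimes>\<^sub>c z4 t) + (z3 t \<otimes>\<^sub>c z5 t)) (at t)"
    "(z6 has_vector_derivative z4 t \<otimes>\<^sub>c z5 t) (at t)" for t
    using D by blast+
  note rules = bounded_linear.has_vector_derivative [OF bounded_linear_scaleR_right]
    has_vector_derivative_add has_vector_derivative_diff d
  show ?thesis
  proof (rule quadratic_evolutionI)
    fix t
    show "((\<lambda>t. (1/2) *\<^sub>R (z1 t + z2 t)) has_vector_derivative
        2 *\<^sub>R (((1/2) *\<^sub>R (z1 t + z2 t)) \<otimes>\<^sub>c z3 t)) (at t)"
      by (rule has_vector_derivative_eq_rhs, (rule rules)+) (simp add: cbil algebra_simps)
    show "((\<lambda>t. (1/2) *\<^sub>R (z1 t - z2 t)) has_vector_derivative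
        2 *\<^sub>R (z3 t \<otimes>\<^sub>c ((1/2) *\<^sub>R (z1 t - z2 t)))) (at t)"
      by (rule has_vector_derivative_eq_rhs, (rule rules)+) (simp add: cbil algebra_simps)
    show "(z3 has_vector_derivative
        4 *\<^sub>R (((1/2) *\<^sub>R (z1 t + z2 t)) \<otimes>\<^sub>c ((1/2) *\<^sub>R (z1 t - z2 t)))) (at t)"
      by (rule has_vector_derivative_eq_rhs, (rule rules)+)
        (simp add: cbil vec_eq_iff algebra_simps)
    show "(z4 has_vector_derivative
        2 *\<^sub>R (((1/2) *\<^sub>R (z1 t + z2 t)) \<otimes>\<^sub>c z5 t) + z4 t \<otimes>\<^sub>c z3 t) (at t)"
      by (rule has_vector_derivative_eq_rhs, (rule rules)+) (simp add: cbil algebra_simps)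
    show "(z5 has_vector_derivative
        z3 t \<otimes>\<^sub>c z5 t + 2 *\<^sub>R (z4 t \<otimes>\<^sub>c ((1/2) *\<^sub>R (z1 t - z2 t)))) (at t)"
      by (rule has_vector_derivative_eq_rhs, (rule rules)+) (simp add: cbil algebra_simps)
    show "(z6 has_vector_derivative z4 t \<otimes>\<^sub>c z5 t) (at t)" by (rule d)
  next
    show "omega (z3 0) (z5 0) + 2 * omega (z4 0) ((1/2) *\<^sub>R (z1 0 - z2 0)) = 0"
      using D by (simp add: bil diff_divide_distrib)
  qed (use D in \<open>simp_all add: bil\<close>)
qed

lemma construction_fold_quadratic:
  "construction_fold z1 z2 z3 z4 z5 z6 =
   quadratic_fold (\<lambda>t. (1/2) *\<^sub>R (z1 t + z2 t)) z3 (\<lambda>t. (1/2) *\<^sub>R (z1 t - z2 t)) z4 z5 z6"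
proof -
  have "((y1\<^sup>2 + y2\<^sup>2) / 2) *\<^sub>R z1 t + ((y1\<^sup>2 - y2\<^sup>2) / 2) *\<^sub>R z2 t + (y1 * y2) *\<^sub>R z3 t
        + y1 *\<^sub>R z4 t + y2 *\<^sub>R z5 t + z6 t =
    quadratic_map (\<lambda>t. (1/2) *\<^sub>R (z1 t + z2 t)) z3 (\<lambda>t. (1/2) *\<^sub>R (z1 t - z2 t)) z4 z5 z6 y1 y2 t"
    for y1 y2 t
    by (simp add: quadratic_map_def vec_eq_iff scaleR_nth field_simps del: vector_scaleR_component)
  then show ?thesis by (simp add: construction_fold_def quadratic_fold_def)
qed

lemma linear_relation_if_dim_lt_3:
  fixes a b c :: "'a::euclidean_space"
  assumes "dim (span {a, b, c}) < 3"
  obtains \<alpha> \<beta> \<gamma> where "\<alpha> *\<^sub>R a + \<beta> *\<^sub>R b + \<gamma> *\<^sub>R c = 0" "\<alpha> \<noteq> 0 \<or> \<beta> \<noteq> 0 \<or> \<gamma> \<noteq> 0"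
proof (rule ccontr)
  assume *: "\<not> thesis"
  note rel = that
  define l where "l = (\<lambda>x :: real^3. x$1 *\<^sub>R a + x$2 *\<^sub>R b + x$3 *\<^sub>R c)"
  have lin: "linear l" by (rule linearI) (simp_all add: l_def algebra_simps)
  have "x = 0" if "l x = 0" for x
    using rel [of "x$1" "x$2" "x$3"] * that unfolding l_def vec3_simps zero_index by blast
  then have "inj l" using linear_injective_0 [OF lin] by blast
  then have "dim (range l) = dim (UNIV :: (real^3) set)"
    by (intro dim_image_eq [OF lin]) simp
  moreover have "range l \<subseteq> span {a, b, c}"
    by (auto simp: l_def intro!: span_add span_scale intro: span_base)
  then have "dim (range l) \<le> dim (span {a, b, c})" by (rule dim_subset)
  ultimately show False using assms by simp
qed

lemma dim_span_neq_2_if_in_line: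
  fixes a b c d :: "'a::euclidean_space"
  assumes "a \<in> span {d}" "b \<in> span {d}" "c \<in> span {d}"
  shows "dim (span {a, b, c}) \<noteq> 2"
proof -
  have "span {a, b, c} \<subseteq> span {d}" using assms by (intro span_minimal) auto
  then have "dim (span {a, b, c}) \<le> dim (span {d})" by (rule dim_subset)
  also have "\<dots> \<le> 1" using dim_le_card [of "span {d}" "{d}"] by simp
  finally show ?thesis by simp
qed

text \<open>This is the case of equality in the Cauchy-Schwarz inequality: as \<open>\<omega>(a, b) = 0\<close>, the Hermitian
  product of \<open>a\<close> and \<open>b\<close> is real.\<close>

lemma in_span_singleton_if_ccross_eq_0:
  assumes "a \<otimes>\<^sub>c b = 0" "omega a b = 0" "a \<noteq> 0"
  shows "b \<in> span {a}"
proof -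
  have aa: "herm a a = complex_of_real (a \<bullet> a)" and bb: "herm b b = complex_of_real (b \<bullet> b)"
    by (simp_all add: complex_eq_iff inner_herm) (simp_all add: herm_expand)
  have ab: "herm a b = complex_of_real (a \<bullet> b)"
    using assms(2) by (simp add: complex_eq_iff inner_herm omega_herm)
  have ba: "herm b a = complex_of_real (a \<bullet> b)"
    using assms(2) omega_skew [of b a] by (simp add: complex_eq_iff inner_herm omega_herm inner_commute)
     (metis inner_commute inner_herm)
  have herm_zero: "herm 0 0 = 0" by (simp add: herm_expand)
  have "complex_of_real ((a \<bullet> a) * (b \<bullet> b) - (a \<bullet> b) * (a \<bullet> b)) = 0"
    using herm_ccross_ccross [of a b] herm_zero unfolding assms(1) aa bb ab ba by simp
  then have "(a \<bullet> a) * (b \<bullet> b) = (a \<bullet> b) * (a \<bullet> b)" by (metis of_real_eq_0_iff right_minus_eq)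
  then have eq: "(a \<bullet> b)\<^sup>2 = (a \<bullet> a) * (b \<bullet> b)" by (simp add: power2_eq_square)
  define r where "r = (a \<bullet> b) / (a \<bullet> a)"
  have "(b - r *\<^sub>R a) \<bullet> (b - r *\<^sub>R a) = 0"
    using eq assms(3) by (simp add: r_def inner_diff inner_commute [of b a] field_simps power2_eq_square)
  then have "b = r *\<^sub>R a" by simp
  then show ?thesis by (metis span_base span_scale singletonI)
qed

text \<open>Only a null vector can be a relation between \<open>z1\<close>, \<open>z2\<close>, \<open>z3\<close>. The volume \<open>vol\<close>, half the real
  part of \<open>\<Omega>(z1, z2, z3)\<close>, vanishes at all times near \<open>t\<close>, and its derivative at \<open>t\<close> is twice the
  quadratic form of signature (1, 2) in the norms of the cross products, which are proportional to
  the coefficients of the relation.\<close>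

lemma null_relation:
  assumes C: "construction_data z1 z2 z3 z4 z5 z6"
    and gen: "for_generic (\<lambda>t. dim (span {z1 t, z2 t, z3 t}) = 2)"
  obtains t b where "z1 t = cos b *\<^sub>R z2 t + sin b *\<^sub>R z3 t" "dim (span {z1 t, z2 t, z3 t}) = 2"
proof -
  obtain S where S: "open S" "closure S = UNIV" "\<And>t. t \<in> S \<Longrightarrow> dim (span {z1 t, z2 t, z3 t}) = 2"
    using gen by (auto simp: for_generic_def)
  then obtain t where t: "t \<in> S" by fastforce
  note D = C [unfolded construction_data_def]
  have d: "(z1 has_vector_derivative 2 *\<^sub>R (z2 t \<otimes>\<^sub>c z3 t)) (at t)"
    "(z2 has_vector_derivative 2 *\<^sub>R (z1 t \<otimes>\<^sub>c z3 t)) (at t)"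
    "(z3 has_vector_derivative (-2) *\<^sub>R (z1 t \<otimes>\<^sub>c z2 t)) (at t)" for t
    using D by blast+
  note QE = quadratic_evolutionD [OF quadratic_evolution_construction_data [OF C]]
  have om: "omega (z1 t) (z2 t) = 0" "omega (z1 t) (z3 t) = 0" "omega (z2 t) (z3 t) = 0"
    using QE(1,2,3) [of t] omega_skew [of "z3 t"] omega_skew [of "z2 t" "z1 t"]
    by (simp_all add: omega.add_left omega.add_right omega.diff_left omega.diff_right
       omega.scaleR_left omega.scaleR_right)
  define vol where "vol t = (z1 t \<otimes>\<^sub>c z2 t) \<bullet> z3 t" for t
  have vol0: "vol s = 0" if s: "s \<in> S" for s
  proof -
    obtain \<alpha> \<beta> \<gamma> where rel: "\<alpha> *\<^sub>R z1 s + \<beta> *\<^sub>R z2 s + \<gamma> *\<^sub>R z3 s = 0"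
      and nz: "\<alpha> \<noteq> 0 \<or> \<beta> \<noteq> 0 \<or> \<gamma> \<noteq> 0"
      using linear_relation_if_dim_lt_3 [of "z1 s" "z2 s" "z3 s"] S(3) [OF s] by auto
    note bil = ccross.add_left ccross.add_right ccross.scaleR_left ccross.scaleR_right
      inner_add inner_ccross_self
    have "((\<alpha> *\<^sub>R z1 s + \<beta> *\<^sub>R z2 s + \<gamma> *\<^sub>R z3 s) \<otimes>\<^sub>c z2 s) \<bullet> z3 s = \<alpha> * vol s"
      "(z1 s \<otimes>\<^sub>c (\<alpha> *\<^sub>R z1 s + \<beta> *\<^sub>R z2 s + \<gamma> *\<^sub>R z3 s)) \<bullet> z3 s = \<beta> * vol s"
      "(z1 s \<otimes>\<^sub>c z2 s) \<bullet> (\<alpha> *\<^sub>R z1 s + \<beta> *\<^sub>R z2 s + \<gamma> *\<^sub>R z3 s) = \<gamma> * vol s"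
      by (simp_all only: bil vol_def) (simp_all add: inner_ccross_self)
    then show ?thesis using nz unfolding rel by (auto simp: ccross.zero_left ccross.zero_right)
  qed
  have "(vol has_vector_derivative (z1 t \<otimes>\<^sub>c z2 t) \<bullet> ((-2) *\<^sub>R (z1 t \<otimes>\<^sub>c z2 t)) +
     (z1 t \<otimes>\<^sub>c (2 *\<^sub>R (z1 t \<otimes>\<^sub>c z3 t)) + (2 *\<^sub>R (z2 t \<otimes>\<^sub>c z3 t)) \<otimes>\<^sub>c z2 t) \<bullet> z3 t) (at t)"
    unfolding vol_def [abs_def]
    by (rule bounded_bilinear.has_vector_derivative [OF bounded_bilinear_inner
        ccross.has_vector_derivative [OF d(1,2)] d(3)])
  moreover have "(vol has_vector_derivative 0) (at t)"
    by (rule has_vector_derivative_transform_within_open [OF has_vector_derivative_const S(1) t])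
      (simp add: vol0)
  ultimately have "(z1 t \<otimes>\<^sub>c z2 t) \<bullet> ((-2) *\<^sub>R (z1 t \<otimes>\<^sub>c z2 t)) +
     (z1 t \<otimes>\<^sub>c (2 *\<^sub>R (z1 t \<otimes>\<^sub>c z3 t)) + (2 *\<^sub>R (z2 t \<otimes>\<^sub>c z3 t)) \<otimes>\<^sub>c z2 t) \<bullet> z3 t = 0"
    by (rule vector_derivative_unique_at)
  moreover have "(z1 t \<otimes>\<^sub>c (z1 t \<otimes>\<^sub>c z3 t)) \<bullet> z3 t = - (norm (z1 t \<otimes>\<^sub>c z3 t))\<^sup>2"
    using arg_cong [OF Omega_ccross [of "z1 t" "z3 t"], of Re] Omega_permute(1) [of "z1 t" "z1 t \<otimes>\<^sub>c z3 t" "z3 t"]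
    by (simp add: inner_ccross)
  moreover have "((z2 t \<otimes>\<^sub>c z3 t) \<otimes>\<^sub>c z2 t) \<bullet> z3 t = (norm (z2 t \<otimes>\<^sub>c z3 t))\<^sup>2"
    using arg_cong [OF Omega_ccross [of "z2 t" "z3 t"], of Re] Omega_permute(3) [of "z2 t \<otimes>\<^sub>c z3 t" "z2 t" "z3 t"]
    by (simp add: inner_ccross)
  ultimately have key: "(norm (z2 t \<otimes>\<^sub>c z3 t))\<^sup>2 = (norm (z1 t \<otimes>\<^sub>c z3 t))\<^sup>2 + (norm (z1 t \<otimes>\<^sub>c z2 t))\<^sup>2"
    by (simp add: ccross.scaleR_left ccross.scaleR_right inner_add power2_norm_eq_inner)
  \<comment> \<open>Otherwise all three cross products vanish, and the three vectors lie on a line.\<close>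
  have nz: "z2 t \<otimes>\<^sub>c z3 t \<noteq> 0"
  proof
    assume eq0: "z2 t \<otimes>\<^sub>c z3 t = 0"
    then have eq0': "z1 t \<otimes>\<^sub>c z3 t = 0" "z1 t \<otimes>\<^sub>c z2 t = 0" using key by (simp_all add: add_nonneg_eq_0_iff)
    have "\<exists>d. z1 t \<in> span {d} \<and> z2 t \<in> span {d} \<and> z3 t \<in> span {d}"
    proof (cases "z1 t = 0")
      case False
      then show ?thesis using in_span_singleton_if_ccross_eq_0 [OF eq0'(1) om(2)]
        in_span_singleton_if_ccross_eq_0 [OF eq0'(2) om(1)] span_base by blast
    next
      case True
      note z1 = True
      show ?thesis
      proof (cases "z2 t = 0")
        case True
        then show ?thesis using z1 by (auto intro: span_base span_zero)
      next
        case False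
        then show ?thesis using in_span_singleton_if_ccross_eq_0 [OF eq0 om(3)] z1
          by (metis span_base span_zero singletonI)
      qed
    qed
    then show False using dim_span_neq_2_if_in_line S(3) [OF t] by blast
  qed
  obtain \<alpha> \<beta> \<gamma> where rel: "\<alpha> *\<^sub>R z1 t + \<beta> *\<^sub>R z2 t + \<gamma> *\<^sub>R z3 t = 0"
    and nz': "\<alpha> \<noteq> 0 \<or> \<beta> \<noteq> 0 \<or> \<gamma> \<noteq> 0"
    using linear_relation_if_dim_lt_3 [of "z1 t" "z2 t" "z3 t"] S(3) [OF t] by auto
  have "(\<alpha> *\<^sub>R z1 t + \<beta> *\<^sub>R z2 t + \<gamma> *\<^sub>R z3 t) \<otimes>\<^sub>c z3 t = \<alpha> *\<^sub>R (z1 t \<otimes>\<^sub>c z3 t) + \<beta> *\<^sub>R (z2 t \<otimes>\<^sub>c z3 t)"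
    "(\<alpha> *\<^sub>R z1 t + \<beta> *\<^sub>R z2 t + \<gamma> *\<^sub>R z3 t) \<otimes>\<^sub>c z2 t = \<alpha> *\<^sub>R (z1 t \<otimes>\<^sub>c z2 t) + \<gamma> *\<^sub>R (z3 t \<otimes>\<^sub>c z2 t)"
    by (simp_all add: ccross.add_left ccross.scaleR_left)
  then have "\<alpha> *\<^sub>R (z1 t \<otimes>\<^sub>c z3 t) = - (\<beta> *\<^sub>R (z2 t \<otimes>\<^sub>c z3 t))"
    "\<alpha> *\<^sub>R (z1 t \<otimes>\<^sub>c z2 t) = \<gamma> *\<^sub>R (z2 t \<otimes>\<^sub>c z3 t)"
    unfolding rel using ccross_skew [of "z3 t" "z2 t"]
    by (simp_all add: ccross.zero_left eq_neg_iff_add_eq_0)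
  then have "(norm (\<alpha> *\<^sub>R (z1 t \<otimes>\<^sub>c z3 t)))\<^sup>2 = (norm (\<beta> *\<^sub>R (z2 t \<otimes>\<^sub>c z3 t)))\<^sup>2"
    "(norm (\<alpha> *\<^sub>R (z1 t \<otimes>\<^sub>c z2 t)))\<^sup>2 = (norm (\<gamma> *\<^sub>R (z2 t \<otimes>\<^sub>c z3 t)))\<^sup>2"
    by simp_all
  then have "\<alpha>\<^sup>2 * (norm (z2 t \<otimes>\<^sub>c z3 t))\<^sup>2 = (\<beta>\<^sup>2 + \<gamma>\<^sup>2) * (norm (z2 t \<otimes>\<^sub>c z3 t))\<^sup>2"
    unfolding key by (simp add: power_mult_distrib algebra_simps) (simp add: key algebra_simps)
  then have sq: "\<alpha>\<^sup>2 = \<beta>\<^sup>2 + \<gamma>\<^sup>2" using nz by simp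
  then have \<alpha>: "\<alpha> \<noteq> 0" using nz' by (auto simp: add_nonneg_eq_0_iff)
  have "(- \<beta> / \<alpha>)\<^sup>2 + (- \<gamma> / \<alpha>)\<^sup>2 = (\<beta>\<^sup>2 + \<gamma>\<^sup>2) / \<alpha>\<^sup>2"
    by (simp add: power_divide add_divide_distrib)
  then have "(- \<beta> / \<alpha>)\<^sup>2 + (- \<gamma> / \<alpha>)\<^sup>2 = 1"
    using \<alpha> by (simp flip: sq)
  then obtain b where b: "- \<beta> / \<alpha> = cos b" "- \<gamma> / \<alpha> = sin b"
    using sincos_total_2pi by metis
  have "\<alpha> *\<^sub>R (cos b *\<^sub>R z2 t + sin b *\<^sub>R z3 t) = - (\<beta> *\<^sub>R z2 t + \<gamma> *\<^sub>R z3 t)"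
    using \<alpha> by (simp add: scaleR_diff_right flip: b)
  also have "\<dots> = \<alpha> *\<^sub>R z1 t"
    using rel by (metis add.assoc eq_neg_iff_add_eq_0)
  finally have "z1 t = cos b *\<^sub>R z2 t + sin b *\<^sub>R z3 t" using \<alpha> by simp
  then show ?thesis using that S(3) [OF t] by blast
qed

text \<open>The relation \<open>z1 = cos b z2 + sin b z3\<close> at time \<open>t0\<close> says that the rotation of the \<open>y\<close>-plane by
  \<open>b/2\<close> makes the coefficient of \<open>y2\<^sup>2\<close> vanish at that time. This coefficient then vanishes always,
  since its derivative is orthogonal to it, and the coefficient of \<open>y1 y2\<close> becomes a constant \<open>q\<close>.
  The coefficient of \<open>y1\<^sup>2\<close> would remain a fixed multiple of \<open>q\<close> if it were one at time \<open>0\<close>, and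
  then the data would span at most a line at time \<open>t0\<close>.\<close>

lemma degenerate_reduction:
  assumes C: "construction_data z1 z2 z3 z4 z5 z6"
    and gen: "for_generic (\<lambda>t. dim (span {z1 t, z2 t, z3 t}) = 2)"
  obtains P q L M K where "quadratic_evolution P (\<lambda>_. q) (\<lambda>_. 0) L M K"
    "construction_fold z1 z2 z3 z4 z5 z6 = quadratic_fold P (\<lambda>_. q) (\<lambda>_. 0) L M K"
    "q \<noteq> 0" "P 0 \<notin> span {q}"
proof -
  obtain t0 b where rel: "z1 t0 = cos b *\<^sub>R z2 t0 + sin b *\<^sub>R z3 t0"
    and dim: "dim (span {z1 t0, z2 t0, z3 t0}) = 2"
    using null_relation [OF C gen] by metis
  define c s where "c = cos (b/2)" "s = sin (b/2)"
  have cs: "c\<^sup>2 + s\<^sup>2 = 1" by (simp add: c_s_def)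
  have cb: "cos b = c\<^sup>2 - s\<^sup>2" using cos_double [of "b/2"] by (simp add: c_s_def)
  have sb: "sin b = 2 * s * c" using sin_double [of "b/2"] by (simp add: c_s_def)
  define P Q R where "P = (\<lambda>t. (1/2) *\<^sub>R (z1 t + z2 t))" "Q = z3" "R = (\<lambda>t. (1/2) *\<^sub>R (z1 t - z2 t))"
  have E0: "quadratic_evolution P Q R z4 z5 z6"
    using quadratic_evolution_construction_data [OF C] by (simp add: P_Q_R_def)
  define P' Q' R' L' M' where "P' = (\<lambda>t. c\<^sup>2 *\<^sub>R P t + (c * s) *\<^sub>R Q t + s\<^sup>2 *\<^sub>R R t)"
    and "Q' = (\<lambda>t. (2 * c * - s) *\<^sub>R P t + (c * c + - s * s) *\<^sub>R Q t + (2 * s * c) *\<^sub>R R t)"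
    and "R' = (\<lambda>t. (- s)\<^sup>2 *\<^sub>R P t + (- s * c) *\<^sub>R Q t + c\<^sup>2 *\<^sub>R R t)"
    and "L' = (\<lambda>t. c *\<^sub>R z4 t + s *\<^sub>R z5 t)" and "M' = (\<lambda>t. - s *\<^sub>R z4 t + c *\<^sub>R z5 t)"
  have one: "1 = c * c - - s * s" using cs by (simp add: power2_eq_square)
  have E: "quadratic_evolution P' Q' R' L' M' z6"
    using quadratic_evolution_linear_change [OF E0 one]
    by (simp add: P'_def Q'_def R'_def L'_def M'_def)
  have fold: "construction_fold z1 z2 z3 z4 z5 z6 = quadratic_fold P' Q' R' L' M' z6"
    using quadratic_fold_linear_change [OF one, of P Q R z4 z5 z6]
    by (simp add: construction_fold_quadratic P_Q_R_def P'_def Q'_def R'_def L'_def M'_def)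
  note D = quadratic_evolutionD [OF E]
  have "R' t0 = (1/2) *\<^sub>R ((c\<^sup>2 + s\<^sup>2) *\<^sub>R z1 t0 - (cos b *\<^sub>R z2 t0 + sin b *\<^sub>R z3 t0))"
    by (simp add: R'_def P_Q_R_def cb sb vec_eq_iff scaleR_nth field_simps del: vector_scaleR_component)
  then have R0: "R' t0 = 0" by (simp add: cs rel)
  have "R' t = 0" for t
  proof -
    have "norm (R' t) = norm (R' t0)"
      by (rule norm_constant [OF D(9)]) (simp add: inner_ccross_self)
    then show ?thesis by (simp add: R0)
  qed
  then have R': "R' = (\<lambda>_. 0)" by blast
  define q where "q = Q' t0"
  have "Q' t = q" for t
    unfolding q_def
    by (rule eq_of_derivative_difference_orthogonal [OF D(8) has_vector_derivative_const])
      (simp_all add: R' ccross.zero_right)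
  then have Q': "Q' = (\<lambda>_. q)" by blast
  have z1: "z1 t0 = P' t0"
  proof -
    have "P' t0 + R' t0 = (c\<^sup>2 + s\<^sup>2) *\<^sub>R (P t0 + R t0)"
      by (simp add: P'_def R'_def algebra_simps)
    then show ?thesis by (simp add: R0 cs) (simp add: P_Q_R_def flip: scaleR_add_right)
  qed
  have q: "q = - sin b *\<^sub>R z2 t0 + cos b *\<^sub>R z3 t0"
    by (simp add: q_def Q'_def P_Q_R_def cb sb vec_eq_iff scaleR_nth power2_eq_square field_simps
         del: vector_scaleR_component)
  have cs1: "cos b * cos b + sin b * sin b = 1"
    using sin_cos_squared_add2 [of b] by (simp add: power2_eq_square)
  have cs2: "(cos b * cos b) *\<^sub>R x + (sin b * sin b) *\<^sub>R x = x" for x :: "complex^3"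
    by (metis cs1 scaleR_add_left scaleR_one)
  have z2: "z2 t0 = cos b *\<^sub>R P' t0 - sin b *\<^sub>R q" and z3: "z3 t0 = sin b *\<^sub>R P' t0 + cos b *\<^sub>R q"
    by (simp_all only: z1 [symmetric] rel q) (simp_all add: algebra_simps cs2)
  have line: False if "P' t0 \<in> span {d}" "q \<in> span {d}" for d
    using dim_span_neq_2_if_in_line [of "z1 t0" d "z2 t0" "z3 t0"] dim that
    unfolding z1 z2 z3 by (simp add: span_add span_diff span_scale)
  have "q \<noteq> 0" using line [of "P' t0"] by (auto intro: span_base span_zero)
  moreover have "P' 0 \<notin> span {q}"
  proof
    assume "P' 0 \<in> span {q}"
    then obtain r where r: "P' 0 = r *\<^sub>R q" by (auto simp: span_singleton)
    have "P' t0 = r *\<^sub>R q"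
      by (rule eq_of_derivative_difference_orthogonal [OF D(7) has_vector_derivative_const _ r])
        (simp add: Q' inner_diff_left inner_ccross_self)
    then show False using line [of q] by (metis span_base span_scale singletonI)
  qed
  ultimately show ?thesis using that E fold unfolding Q' R' by blast
qed

section \<open>The normal form\<close>

text \<open>A solution is determined by its values at time \<open>0\<close>, up to a translation of \<open>K\<close>, so only these
  values have to be matched. The linear change of \<open>(y1, y2)\<close> with matrix entries \<open>a\<close>, \<open>0\<close>, \<open>- s a\<close>,
  \<open>m\<close> removes the component \<open>s q\<close> of \<open>P 0\<close> along \<open>q\<close>, scales its remainder \<open>w\<close> to norm \<open>\<surd>2\<close> and
  scales \<open>q\<close> to norm 1; because of \<open>\<omega>(P, q) = 0\<close> the results are orthogonal for the Hermitian
  product too. The shift \<open>h\<close> of \<open>y1\<close> then removes the third component of \<open>M 0\<close>, and the shift \<open>k\<close> of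
  \<open>y2\<close> corrects the real part of the third component of \<open>L 0\<close>.\<close>

lemma degenerate_normal_form:
  assumes E: "quadratic_evolution P (\<lambda>_. q) (\<lambda>_. 0) L M K"
    and q: "q \<noteq> 0" and P0: "P 0 \<notin> span {q}"
  shows "\<exists>A B D E F. Im (A * cnj D + B * cnj E) = 0 \<and> automorphism F
    \<and> F ` quadratic_fold P (\<lambda>_. q) (\<lambda>_. 0) L M K = family_fold A B D E"
proof -
  define s where "s = (P 0 \<bullet> q) / (q \<bullet> q)"
  define w where "w = P 0 - s *\<^sub>R q"
  have "w \<noteq> 0"
    using P0 by (auto simp: w_def span_singleton)
  define \<rho> \<kappa> where "\<rho> = norm w / sqrt 2" and "\<kappa> = norm q"
  have pos: "\<rho> > 0" "\<kappa> > 0" using \<open>w \<noteq> 0\<close> q by (simp_all add: \<rho>_def \<kappa>_def)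
  define a where "a = 1 / sqrt \<rho>"
  have aa: "a\<^sup>2 = 1 / \<rho>" "a \<noteq> 0" using pos by (simp_all add: a_def power_divide)
  define d m where "d = 1 / \<kappa>" and "m = sqrt \<rho> / \<kappa>"
  have d: "d = a * m - 0 * (- s * a)" "d \<noteq> 0"
    using pos by (simp_all add: d_def m_def a_def)
  define P1 where "P1 = (\<lambda>t. a\<^sup>2 *\<^sub>R P (d * t) + (a * (- s * a)) *\<^sub>R q)"
  define e where "e = d *\<^sub>R q"
  define L1 M1 K1 where "L1 = (\<lambda>t. a *\<^sub>R L (d * t) + (- s * a) *\<^sub>R M (d * t))"
    and "M1 = (\<lambda>t. m *\<^sub>R M (d * t))" and "K1 = (\<lambda>t. K (d * t))"
  have "a * m = d" using d by simp
  note unfold = P1_def e_def L1_def M1_def K1_def this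
  have E1: "quadratic_evolution P1 (\<lambda>_. e) (\<lambda>_. 0) L1 M1 K1"
    using quadratic_evolution_linear_change [OF E d(1)] by (simp add: unfold)
  have fold1: "quadratic_fold P1 (\<lambda>_. e) (\<lambda>_. 0) L1 M1 K1 = quadratic_fold P (\<lambda>_. q) (\<lambda>_. 0) L M K"
    using quadratic_fold_linear_change [OF d, of P "\<lambda>_. q" "\<lambda>_. 0" L M K] by (simp add: unfold)
  have "P1 0 = a\<^sup>2 *\<^sub>R w"
    by (simp add: P1_def w_def power2_eq_square algebra_simps)
  then have P1w: "P1 0 = (1 / \<rho>) *\<^sub>R w" using aa by simp
  have ee: "herm e e = 1"
    using pos q by (simp add: herm_self e_def d_def \<kappa>_def)
  have pp: "herm (P1 0) (P1 0) = 2"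
  proof -
    have "(norm (P1 0))\<^sup>2 = 2" using pos \<open>w \<noteq> 0\<close>
      by (simp add: P1w power_divide) (simp add: \<rho>_def power_divide)
    then show ?thesis by (simp only: herm_self) simp
  qed
  have ep: "herm e (P1 0) = 0"
  proof -
    have "w \<bullet> q = 0" using q by (simp add: w_def s_def inner_diff_left)
    then have "e \<bullet> P1 0 = 0" by (simp add: e_def P1w inner_commute [of q])
    moreover have "omega e (P1 0) = 0"
      using quadratic_evolutionD(1) [OF E1, of 0] omega_skew [of e "P1 0"] by simp
    ultimately show ?thesis by (simp add: complex_eq_iff inner_herm omega_herm)
  qed
  obtain U where U: "special_unitary U" "U *v e = vector [0, 0, 1]" "U *v P1 0 = vector [1, -\<i>, 0]"
    by (rule special_unitary_frame [OF ee pp ep])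
  define P2 L2 M2 K2 where "P2 = (\<lambda>t. U *v P1 t)" and "L2 = (\<lambda>t. U *v L1 t)"
    and "M2 = (\<lambda>t. U *v M1 t)" and "K2 = (\<lambda>t. U *v K1 t)"
  have E2: "quadratic_evolution P2 (\<lambda>_. family_Q) (\<lambda>_. 0) L2 M2 K2"
    using quadratic_evolution_special_unitary [OF U(1) E1] U(2)
    by (simp add: P2_def L2_def M2_def K2_def family_Q_def)
  have fold2: "quadratic_fold P2 (\<lambda>_. family_Q) (\<lambda>_. 0) L2 M2 K2
      = (\<lambda>v. U *v v) ` quadratic_fold P1 (\<lambda>_. e) (\<lambda>_. 0) L1 M1 K1"
    using quadratic_fold_affine [of U 0 P1 "\<lambda>_. e" "\<lambda>_. 0" L1 M1 K1] U(2)
    by (simp add: P2_def L2_def M2_def K2_def family_Q_def)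
  have P2: "P2 0 = family_P 0" using U(3) by (simp add: P2_def family_P_def)
  have imM: "Im (M2 0 $ 3) = 0"
    using quadratic_evolutionD(5) [OF E2, of 0]
    by (simp add: omega_herm herm_expand family_Q_def)
  define h where "h = - Re (M2 0 $ 3)"
  \<comment> \<open>The solutions of the two equations for \<open>A\<close> and \<open>B\<close> that hold in the family at time \<open>0\<close>.\<close>
  define A B where "A = ((M2 0 $ 1) + \<i> * cnj (M2 0 $ 2)) / 2" and "B = ((M2 0 $ 1) - \<i> * cnj (M2 0 $ 2)) / 2"
  have AB: "A + B = M2 0 $ 1" "\<i> * (cnj A - cnj B) = M2 0 $ 2"
    by (simp_all add: A_def B_def field_simps)
  define l where "l = L2 0 + (2 * h) *\<^sub>R P2 0"
  \<comment> \<open>Likewise for \<open>D\<close> and the fourth parameter, here called \<open>G\<close>, after the shift by \<open>h\<close>.\<close>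
  define D G where "D = ((l $ 1) - \<i> * cnj (l $ 2)) / 2" and "G = ((l $ 1) + \<i> * cnj (l $ 2)) / 2"
  have DG: "D + G = l $ 1" "\<i> * (- cnj D + cnj G) = l $ 2"
    by (simp_all add: D_def G_def field_simps)
  \<comment> \<open>The third component of \<open>L\<close> depends only on \<open>A\<close> and \<open>B\<close>.\<close>
  define k where "k = Re (family_L A B D G 0 $ 3) - Re (l $ 3)"
  define L3 M3 K3 where "L3 = (\<lambda>t. L2 t + (2 * h) *\<^sub>R P2 t + k *\<^sub>R family_Q)"
    and "M3 = (\<lambda>t. M2 t + h *\<^sub>R family_Q)"
    and "K3 = (\<lambda>t. K2 t + h *\<^sub>R L2 t + k *\<^sub>R M2 t + h\<^sup>2 *\<^sub>R P2 t + (h * k) *\<^sub>R family_Q)"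
  have E3: "quadratic_evolution P2 (\<lambda>_. family_Q) (\<lambda>_. 0) L3 M3 K3"
    using quadratic_evolution_shift [OF E2, of h k] by (simp add: L3_def M3_def K3_def)
  have fold3: "quadratic_fold P2 (\<lambda>_. family_Q) (\<lambda>_. 0) L3 M3 K3
      = quadratic_fold P2 (\<lambda>_. family_Q) (\<lambda>_. 0) L2 M2 K2"
    using quadratic_fold_shift [of P2 "\<lambda>_. family_Q" "\<lambda>_. 0" L2 h k M2 K2]
    by (simp add: L3_def M3_def K3_def)
  have M3: "M3 0 = family_M A B 0"
    using imM AB by (simp add: M3_def family_M_def family_Q_def vec3_simps h_def complex_eq_iff)
  have imL: "Im (L3 0 $ 3) = Im (family_L A B D G 0 $ 3)"
  proof -
    have "2 * omega (family_P 0) (family_M A B 0) + omega (L3 0) family_Q = 0"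
      using quadratic_evolutionD(4) [OF E3, of 0] by (simp add: M3 P2)
    then show ?thesis
      by (simp add: omega_herm herm_expand family_P_def family_M_def family_L_def family_Q_def)
  qed
  have L3: "L3 0 = family_L A B D G 0"
  proof -
    have "L3 0 = l + k *\<^sub>R family_Q" by (simp add: L3_def l_def)
    moreover have "L3 0 $ 3 = family_L A B D G 0 $ 3"
      using imL by (simp add: complex_eq_iff) (simp add: L3_def k_def l_def family_Q_def)
    ultimately show ?thesis
      using DG by (simp add: family_L_def family_Q_def vec3_simps)
  qed
  have im: "Im (A * cnj D + B * cnj G) = 0"
    using quadratic_evolutionD(6) [OF E3, of 0]
    by (simp add: L3 M3 omega_herm herm_expand family_L_def family_M_def algebra_simps)
  note unique = quadratic_evolution_unique [OF E3 quadratic_evolution_family [OF im] P2 L3 M3]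
  define b where "b = family_K A B D G 0 - K3 0"
  have "family_K A B D G t = K3 t + b" for t
    unfolding b_def by (subst unique(4) [of t]) simp
  then have K: "family_K A B D G = (\<lambda>t. K3 t + b)" by blast
  have "family_fold A B D G = quadratic_fold P2 (\<lambda>_. family_Q) (\<lambda>_. 0) L3 M3 (\<lambda>t. K3 t + b)"
    unfolding family_fold_quadratic K unique(1-3) ..
  also have "\<dots> = (\<lambda>v. v + b) ` quadratic_fold P2 (\<lambda>_. family_Q) (\<lambda>_. 0) L3 M3 K3"
    using quadratic_fold_affine [of "mat 1" b P2 "\<lambda>_. family_Q" "\<lambda>_. 0" L3 M3 K3] by simp
  also have "\<dots> = (\<lambda>v. v + b) ` quadratic_fold P2 (\<lambda>_. family_Q) (\<lambda>_. 0) L2 M2 K2"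
    by (simp only: fold3)
  also have "\<dots> = (\<lambda>v. U *v v + b) ` quadratic_fold P1 (\<lambda>_. e) (\<lambda>_. 0) L1 M1 K1"
    unfolding fold2 image_image ..
  also have "\<dots> = (\<lambda>v. U *v v + b) ` quadratic_fold P (\<lambda>_. q) (\<lambda>_. 0) L M K"
    by (simp only: fold1)
  finally have "(\<lambda>v. U *v v + b) ` quadratic_fold P (\<lambda>_. q) (\<lambda>_. 0) L M K = family_fold A B D G" ..
  moreover have "automorphism (\<lambda>v. U *v v + b)" using U(1) by (auto simp: automorphism_def)
  ultimately show ?thesis using im by blast
qed

theorem theorem8p4:
  "(\<forall>A B D E :: complex. Im (A * cnj D + B * cnj E) = 0 \<longrightarrow>
      special_lagrangian_where_nonsingular (family_fold A B D E))
   \<and>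
   (\<forall>z1 z2 z3 z4 z5 z6 :: real \<Rightarrow> complex^3.
      construction_data z1 z2 z3 z4 z5 z6
      \<and> for_generic (\<lambda>t. dim (span {z1 t, z2 t, z3 t}) = 2) \<longrightarrow>
      (\<exists>A B D E :: complex. \<exists>F. Im (A * cnj D + B * cnj E) = 0 \<and> automorphism F
         \<and> F ` construction_fold z1 z2 z3 z4 z5 z6 = family_fold A B D E))"
proof (intro conjI allI impI)
  fix A B D E :: complex
  assume "Im (A * cnj D + B * cnj E) = 0"
  then show "special_lagrangian_where_nonsingular (family_fold A B D E)"
    unfolding family_fold_quadratic
    by (intro special_lagrangian_quadratic_fold quadratic_evolution_family)
next
  fix z1 z2 z3 z4 z5 z6 :: "real \<Rightarrow> complex^3"
  assume "construction_data z1 z2 z3 z4 z5 z6 \<and> for_generic (\<lambda>t. dim (span {z1 t, z2 t, z3 t}) = 2)"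
  then have C: "construction_data z1 z2 z3 z4 z5 z6"
    and gen: "for_generic (\<lambda>t. dim (span {z1 t, z2 t, z3 t}) = 2)" by simp_all
  obtain P q L M K where E: "quadratic_evolution P (\<lambda>_. q) (\<lambda>_. 0) L M K"
    and fold: "construction_fold z1 z2 z3 z4 z5 z6 = quadratic_fold P (\<lambda>_. q) (\<lambda>_. 0) L M K"
    and q: "q \<noteq> 0" "P 0 \<notin> span {q}"
    by (rule degenerate_reduction [OF C gen])
  show "\<exists>A B D E :: complex. \<exists>F. Im (A * cnj D + B * cnj E) = 0 \<and> automorphism F
         \<and> F ` construction_fold z1 z2 z3 z4 z5 z6 = family_fold A B D E"
    unfolding fold by (rule degenerate_normal_form [OF E q])
qed

end
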